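(* Let $d\ge1$ and let $V\subset\mathcal{O}(\mathbb{C}^d)$ be a quasi-Banach space with continuous inclusion. Assume that the following two conditions hold: (1) for every $p\in\mathbb{C}^d$, one has $\mathfrak{m}_p^n/\mathfrak{m}_p^{n+1}=V_{p,n}/V_{p,n+1}$ for infinitely many $n\ge0$; (2) for every $a\in(0,1)$ and every $U\in\mathrm{SU}(d)$, there exists a nonvanishing function $v\in\mathcal{O}(\mathbb{C}^d)$ such that $vC_{aU}$ is bounded on $V$. Let $f:\mathbb{C}^d\to\mathbb{C}^d$ be holomorphic and let $u\in\mathcal{O}(\mathbb{C}^d)$ be nonvanishing. If $uC_f$ is bounded on $V$, then $f$ is affine.
   Context: $\mathcal{O}(\mathbb{C}^d)$ is the space of entire functions on $\mathbb{C}^d$ with the topology of uniform convergence on compact sets. A quasi-Banach space is a complete Hausdorff topological vector space whose topology is given by a quasi-norm: a map $\|\cdot\|_V:V\to\mathbb{R}_{\ge0}$ with $\|av\|_V=|a|\|v\|_V$, $\|v+w\|_V\le K(\|v\|_V+\|w\|_V)$ for some $K\ge1$ independent of $v,w$, and $\|v\|_V=0\Rightarrow v=0$. "$V\subset\mathcal{O}(\mathbb{C}^d)$ with continuous inclusion" means $V$ is a complex linear subspace of $\mathcal{O}(\mathbb{C}^d)$, with its own topology, such that the inclusion is continuous. For holomorphic $g:\mathbb{C}^d\to\mathbb{C}^d$ and $w\in\mathcal{O}(\mathbb{C}^d)$, the weighted composition operator $wC_g$ on $V$ is $h\mapsto w\cdot(h\circ g)$ with domain $\{h\in V:w\cdot(h\circ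 g)\in V\}$; it is bounded on $V$ if its domain is all of $V$ and it is a bounded operator $V\to V$. "Nonvanishing" means having no zeros. $\mathrm{SU}(d)$ is the group of unitary $d\times d$ matrices of determinant $1$, and $aU$ denotes the linear map $z\mapsto aUz$. A map $f$ is affine if $f(z)=Az+b$ for some $d\times d$ complex matrix $A$ and $b\in\mathbb{C}^d$. For $p\in\mathbb{C}^d$, $\mathfrak{m}_p$ is the maximal ideal of the ring of germs of holomorphic functions at $p$ (and $\mathfrak{m}_p^0$ is the whole ring); $V_{p,n}$ is the set of $h\in V$ whose germ at $p$ lies in $\mathfrak{m}_p^n$ (all Taylor coefficients at $p$ of total degree $<n$ vanish). $V_{p,n}/V_{p,n+1}$ is naturally regarded as a subspace of $\mathfrak{m}_p^n/\mathfrak{m}_p^{n+1}$. *)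

theory Defs
  imports "HOL-Analysis.Analysis" "HOL-Algebra.Ideal_Product"
begin

section \<open>Holomorphic functions on \<open>\<complex>\<^sup>d\<close>\<close>

text \<open>The index type \<open>'n\<close> plays the role of \<open>{1..d}\<close>, i.e. \<open>d = CARD('n) \<ge> 1\<close>.
  Holomorphic means complex differentiable: the real Frechet derivative is complex linear.\<close>

definition holo_on :: "(complex ^ 'n \<Rightarrow> complex) \<Rightarrow> (complex ^ 'n) set \<Rightarrow> bool" where
  "holo_on h S \<longleftrightarrow>
     (\<forall>z\<in>S. \<exists>D. (h has_derivative D) (at z) \<and> (\<forall>c v. D (c *s v) = c * D v))"

definition entire :: "(complex ^ 'n \<Rightarrow> complex) set" where
  "entire = {h. holo_on h UNIV}"

definition holo_map :: "(complex ^ 'n \<Rightarrow> complex ^ 'n) \<Rightarrow> bool" where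
  "holo_map f \<longleftrightarrow> (\<forall>i. (\<lambda>z. f z $ i) \<in> entire)"

definition affine_map :: "(complex ^ 'n \<Rightarrow> complex ^ 'n) \<Rightarrow> bool" where
  "affine_map f \<longleftrightarrow> (\<exists>(A :: complex ^ 'n ^ 'n) b. \<forall>z. f z = A *v z + b)"

definition nonvanishing :: "(complex ^ 'n \<Rightarrow> complex) \<Rightarrow> bool" where
  "nonvanishing w \<longleftrightarrow> (\<forall>z. w z \<noteq> 0)"

definition conj_transpose :: "complex ^ 'n ^ 'n \<Rightarrow> complex ^ 'n ^ 'n" where
  "conj_transpose U = (\<chi> i j. cnj (U $ j $ i))"

definition SU :: "(complex ^ 'n ^ 'n) set" where
  "SU = {U. conj_transpose U ** U = mat 1 \<and> U ** conj_transpose U = mat 1 \<and> det U = 1}"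

text \<open>The topology of uniform convergence on compact sets.\<close>

definition entire_topology :: "(complex ^ 'n \<Rightarrow> complex) topology" where
  "entire_topology = topology (\<lambda>W. W \<subseteq> entire \<and>
     (\<forall>h\<in>W. \<exists>K e. compact K \<and> e > 0 \<and>
        (\<forall>g\<in>entire. (\<forall>z\<in>K. cmod (g z - h z) < e) \<longrightarrow> g \<in> W)))"

lemma openin_entire_topology:
  "openin entire_topology W \<longleftrightarrow> W \<subseteq> entire \<and>
     (\<forall>h\<in>W. \<exists>K e. compact K \<and> e > 0 \<and>
        (\<forall>g\<in>entire. (\<forall>z\<in>K. cmod (g z - h z) < e) \<longrightarrow> g \<in> W))"
proof -
  let ?P = "\<lambda>h W. \<exists>K e. compact K \<and> e > 0 \<and>
        (\<forall>g\<in>entire. (\<forall>z\<in>K. cmod (g z - h z) < e) \<longrightarrow> g \<in> W)"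
  have "istopology (\<lambda>W. W \<subseteq> entire \<and> (\<forall>h\<in>W. ?P h W))"
    unfolding istopology_def
  proof (intro conjI allI impI)
    fix S T :: "(complex ^ 'n \<Rightarrow> complex) set"
    assume S: "S \<subseteq> entire \<and> (\<forall>h\<in>S. ?P h S)" and T: "T \<subseteq> entire \<and> (\<forall>h\<in>T. ?P h T)"
    show "S \<inter> T \<subseteq> entire" using S by blast
    show "\<forall>h\<in>S \<inter> T. ?P h (S \<inter> T)"
    proof
      fix h assume h: "h \<in> S \<inter> T"
      obtain K e where K: "compact K" "e > 0"
        "\<forall>g\<in>entire. (\<forall>z\<in>K. cmod (g z - h z) < e) \<longrightarrow> g \<in> S" using S h by blast
      obtain L e' where L: "compact L" "e' > 0"
        "\<forall>g\<in>entire. (\<forall>z\<in>L. cmod (g z - h z) < e') \<longrightarrow> g \<in> T" using T h by blast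
      have "compact (K \<union> L)" "min e e' > 0" using K L by auto
      moreover have "\<forall>g\<in>entire. (\<forall>z\<in>K \<union> L. cmod (g z - h z) < min e e') \<longrightarrow> g \<in> S \<inter> T"
        using K(3) L(3) by simp
      ultimately show "?P h (S \<inter> T)" by blast
    qed
  next
    fix \<K> :: "(complex ^ 'n \<Rightarrow> complex) set set"
    assume \<K>: "\<forall>S\<in>\<K>. S \<subseteq> entire \<and> (\<forall>h\<in>S. ?P h S)"
    show "\<Union>\<K> \<subseteq> entire" using \<K> by blast
    show "\<forall>h\<in>\<Union>\<K>. ?P h (\<Union>\<K>)"
    proof
      fix h assume "h \<in> \<Union>\<K>"
      then obtain S where "S \<in> \<K>" "h \<in> S" by blast
      with \<K> obtain K e where "compact K" "e > 0"
        "\<forall>g\<in>entire. (\<forall>z\<in>K. cmod (g z - h z) < e) \<longrightarrow> g \<in> S" by meson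
      with \<open>S \<in> \<K>\<close> show "?P h (\<Union>\<K>)" by blast
    qed
  qed
  from topology_inverse'[OF this] show ?thesis unfolding entire_topology_def by (rule fun_cong)
qed


section \<open>Quasi-Banach spaces of functions\<close>

text \<open>\<open>N\<close> is a quasi-norm on the complex linear space \<open>V\<close> of functions; only its values on
  \<open>V\<close> matter.\<close>

definition function_subspace :: "('a \<Rightarrow> complex) set \<Rightarrow> bool" where
  "function_subspace V \<longleftrightarrow> (\<lambda>x. 0) \<in> V \<and>
     (\<forall>g\<in>V. \<forall>h\<in>V. (\<lambda>x. g x + h x) \<in> V) \<and> (\<forall>a. \<forall>h\<in>V. (\<lambda>x. a * h x) \<in> V)"

definition quasi_norm :: "('a \<Rightarrow> complex) set \<Rightarrow> (('a \<Rightarrow> complex) \<Rightarrow> real) \<Rightarrow> bool" where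
  "quasi_norm V N \<longleftrightarrow>
     (\<forall>h\<in>V. N h \<ge> 0) \<and>
     (\<forall>a. \<forall>h\<in>V. N (\<lambda>x. a * h x) = cmod a * N h) \<and>
     (\<exists>K\<ge>1. \<forall>g\<in>V. \<forall>h\<in>V. N (\<lambda>x. g x + h x) \<le> K * (N g + N h)) \<and>
     (\<forall>h\<in>V. N h = 0 \<longrightarrow> h = (\<lambda>x. 0))"

text \<open>The linear topology having the sets \<open>{g \<in> V. N g < e}\<close> as a neighbourhood base at \<open>0\<close>.
  These sets need not be open themselves, as \<open>N\<close> need not be continuous.\<close>

definition quasi_norm_topology ::
    "('a \<Rightarrow> complex) set \<Rightarrow> (('a \<Rightarrow> complex) \<Rightarrow> real) \<Rightarrow> ('a \<Rightarrow> complex) topology" where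
  "quasi_norm_topology V N = topology (\<lambda>W. W \<subseteq> V \<and>
     (\<forall>h\<in>W. \<exists>e>0. \<forall>g\<in>V. N (\<lambda>x. g x - h x) < e \<longrightarrow> g \<in> W))"

lemma openin_quasi_norm_topology:
  "openin (quasi_norm_topology V N) W \<longleftrightarrow> W \<subseteq> V \<and>
     (\<forall>h\<in>W. \<exists>e>0. \<forall>g\<in>V. N (\<lambda>x. g x - h x) < e \<longrightarrow> g \<in> W)"
proof -
  let ?P = "\<lambda>h W. \<exists>e>0. \<forall>g\<in>V. N (\<lambda>x. g x - h x) < e \<longrightarrow> g \<in> W"
  have "istopology (\<lambda>W. W \<subseteq> V \<and> (\<forall>h\<in>W. ?P h W))"
    unfolding istopology_def
  proof (intro conjI allI impI)
    fix S T :: "('a \<Rightarrow> complex) set"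
    assume S: "S \<subseteq> V \<and> (\<forall>h\<in>S. ?P h S)" and T: "T \<subseteq> V \<and> (\<forall>h\<in>T. ?P h T)"
    show "S \<inter> T \<subseteq> V" using S by blast
    show "\<forall>h\<in>S \<inter> T. ?P h (S \<inter> T)"
    proof
      fix h assume h: "h \<in> S \<inter> T"
      obtain e where e: "e > 0" "\<forall>g\<in>V. N (\<lambda>x. g x - h x) < e \<longrightarrow> g \<in> S" using S h by blast
      obtain e' where e': "e' > 0" "\<forall>g\<in>V. N (\<lambda>x. g x - h x) < e' \<longrightarrow> g \<in> T" using T h by blast
      show "?P h (S \<inter> T)" by (rule exI[of _ "min e e'"]) (use e e' in simp)
    qed
  next
    fix \<K> :: "('a \<Rightarrow> complex) set set"
    assume \<K>: "\<forall>S\<in>\<K>. S \<subseteq> V \<and> (\<forall>h\<in>S. ?P h S)"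
    show "\<Union>\<K> \<subseteq> V" using \<K> by blast
    show "\<forall>h\<in>\<Union>\<K>. ?P h (\<Union>\<K>)" using \<K> by (meson UnionE UnionI)
  qed
  from topology_inverse'[OF this] show ?thesis unfolding quasi_norm_topology_def by (rule fun_cong)
qed

definition quasi_Banach :: "('a \<Rightarrow> complex) set \<Rightarrow> (('a \<Rightarrow> complex) \<Rightarrow> real) \<Rightarrow> bool" where
  "quasi_Banach V N \<longleftrightarrow> function_subspace V \<and> quasi_norm V N \<and>
     (\<forall>s. (\<forall>k. s k \<in> V) \<and>
          (\<forall>e>0. \<exists>M. \<forall>j\<ge>M. \<forall>k\<ge>M. N (\<lambda>x. s j x - s k x) < e) \<longrightarrow>
          (\<exists>l\<in>V. (\<lambda>k. N (\<lambda>x. s k x - l x)) \<longlonglongrightarrow> 0))"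

definition continuously_included ::
    "(complex ^ 'n \<Rightarrow> complex) set \<Rightarrow> ((complex ^ 'n \<Rightarrow> complex) \<Rightarrow> real) \<Rightarrow> bool" where
  "continuously_included V N \<longleftrightarrow> V \<subseteq> entire \<and>
     continuous_map (quasi_norm_topology V N) entire_topology (\<lambda>h. h)"


section \<open>Weighted composition operators\<close>

definition wcomp ::
    "('a \<Rightarrow> complex) \<Rightarrow> ('a \<Rightarrow> 'a) \<Rightarrow> ('a \<Rightarrow> complex) \<Rightarrow> 'a \<Rightarrow> complex" where
  "wcomp w g h = (\<lambda>z. w z * h (g z))"

definition wcomp_dom :: "('a \<Rightarrow> complex) set \<Rightarrow> ('a \<Rightarrow> complex) \<Rightarrow> ('a \<Rightarrow> 'a) \<Rightarrow> ('a \<Rightarrow> complex) set" where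
  "wcomp_dom V w g = {h \<in> V. wcomp w g h \<in> V}"

definition wcomp_bounded ::
    "('a \<Rightarrow> complex) set \<Rightarrow> (('a \<Rightarrow> complex) \<Rightarrow> real) \<Rightarrow> ('a \<Rightarrow> complex) \<Rightarrow> ('a \<Rightarrow> 'a) \<Rightarrow> bool" where
  "wcomp_bounded V N w g \<longleftrightarrow>
     wcomp_dom V w g = V \<and> (\<exists>C. \<forall>h\<in>V. N (wcomp w g h) \<le> C * N h)"


section \<open>Germs\<close>

definition holo_near :: "complex ^ 'n \<Rightarrow> (complex ^ 'n \<Rightarrow> complex) \<Rightarrow> bool" where
  "holo_near p f \<longleftrightarrow> (\<exists>S. open S \<and> p \<in> S \<and> holo_on f S)"

definition germ :: "complex ^ 'n \<Rightarrow> (complex ^ 'n \<Rightarrow> complex) \<Rightarrow> (complex ^ 'n \<Rightarrow> complex) set" where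
  "germ p f = {g. \<forall>\<^sub>F z in nhds p. g z = f z}"

definition germ_ring :: "complex ^ 'n \<Rightarrow> (complex ^ 'n \<Rightarrow> complex) set ring" where
  "germ_ring p = \<lparr> carrier = germ p ` {f. holo_near p f},
     mult = (\<lambda>A B. {h. \<exists>f\<in>A. \<exists>g\<in>B. \<forall>\<^sub>F z in nhds p. h z = f z * g z}),
     one = germ p (\<lambda>z. 1),
     zero = germ p (\<lambda>z. 0),
     add = (\<lambda>A B. {h. \<exists>f\<in>A. \<exists>g\<in>B. \<forall>\<^sub>F z in nhds p. h z = f z + g z}) \<rparr>"

definition germ_max :: "complex ^ 'n \<Rightarrow> (complex ^ 'n \<Rightarrow> complex) set set" where
  "germ_max p = germ p ` {f. holo_near p f \<and> f p = 0}"

text \<open>The power is taken in the monoid of ideals, whose product is the product of ideals and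
  whose neutral element is the whole ring.\<close>

definition germ_max_pow :: "complex ^ 'n \<Rightarrow> nat \<Rightarrow> (complex ^ 'n \<Rightarrow> complex) set set" where
  "germ_max_pow p n = germ_max p [^]\<^bsub>ideals_set (germ_ring p)\<^esub> n"

definition vanishing_subspace ::
    "(complex ^ 'n \<Rightarrow> complex) set \<Rightarrow> complex ^ 'n \<Rightarrow> nat \<Rightarrow> (complex ^ 'n \<Rightarrow> complex) set" where
  "vanishing_subspace V p n = {h \<in> V. germ p h \<in> germ_max_pow p n}"

definition graded_piece :: "complex ^ 'n \<Rightarrow> nat \<Rightarrow> (complex ^ 'n \<Rightarrow> complex) set set set" where
  "graded_piece p n =
     (\<lambda>x. germ_max_pow p (Suc n) +>\<^bsub>germ_ring p\<^esub> x) ` germ_max_pow p n"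

text \<open>The space \<open>V\<^bsub>p,n\<^esub> / V\<^bsub>p,n+1\<^esub>\<close>, regarded as a subspace of \<open>graded_piece p n\<close>: two elements
  of \<open>V\<^bsub>p,n\<^esub>\<close> have the same image here iff their difference lies in \<open>V\<^bsub>p,n+1\<^esub>\<close>.\<close>

definition graded_piece_of ::
    "(complex ^ 'n \<Rightarrow> complex) set \<Rightarrow> complex ^ 'n \<Rightarrow> nat \<Rightarrow> (complex ^ 'n \<Rightarrow> complex) set set set" where
  "graded_piece_of V p n =
     (\<lambda>h. germ_max_pow p (Suc n) +>\<^bsub>germ_ring p\<^esub> germ p h) ` vanishing_subspace V p n"


subsection \<open>The ring of germs and its maximal ideal\<close>

lemma holo_on_const: "holo_on (\<lambda>z. c) S"
  unfolding holo_on_def by (auto intro!: exI[of _ "\<lambda>v. 0"])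

lemma holo_on_add:
  assumes "holo_on f S" "holo_on g S"
  shows "holo_on (\<lambda>z. f z + g z) S"
  unfolding holo_on_def
proof
  fix z assume "z \<in> S"
  with assms obtain D E where "(f has_derivative D) (at z)" "\<forall>c v. D (c *s v) = c * D v"
    "(g has_derivative E) (at z)" "\<forall>c v. E (c *s v) = c * E v" unfolding holo_on_def by blast
  thus "\<exists>D. ((\<lambda>z. f z + g z) has_derivative D) (at z) \<and> (\<forall>c v. D (c *s v) = c * D v)"
    by (intro exI[of _ "\<lambda>v. D v + E v"]) (auto intro!: has_derivative_add simp: algebra_simps)
qed

lemma holo_on_mult:
  assumes "holo_on f S" "holo_on g S"
  shows "holo_on (\<lambda>z. f z * g z) S"
  unfolding holo_on_def
proof
  fix z assume "z \<in> S"
  with assms obtain D E where "(f has_derivative D) (at z)" "\<forall>c v. D (c *s v) = c * D v"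
    "(g has_derivative E) (at z)" "\<forall>c v. E (c *s v) = c * E v" unfolding holo_on_def by blast
  thus "\<exists>D. ((\<lambda>z. f z * g z) has_derivative D) (at z) \<and> (\<forall>c v. D (c *s v) = c * D v)"
    by (intro exI[of _ "\<lambda>v. f z * E v + D v * g z"])
       (simp add: has_derivative_mult, simp add: algebra_simps)
qed

lemma holo_on_subset: "holo_on f S \<Longrightarrow> T \<subseteq> S \<Longrightarrow> holo_on f T"
  unfolding holo_on_def by blast

lemma holo_near_const: "holo_near p (\<lambda>z. c)"
  unfolding holo_near_def using holo_on_const by blast

lemma holo_near_add:
  assumes "holo_near p f" "holo_near p g"
  shows "holo_near p (\<lambda>z. f z + g z)"
proof -
  obtain S T where "open S" "p \<in> S" "holo_on f S" "open T" "p \<in> T" "holo_on g T"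
    using assms unfolding holo_near_def by blast
  hence "open (S \<inter> T)" "p \<in> S \<inter> T" "holo_on (\<lambda>z. f z + g z) (S \<inter> T)"
    by (auto intro!: holo_on_add elim: holo_on_subset)
  thus ?thesis unfolding holo_near_def by blast
qed

lemma holo_near_mult:
  assumes "holo_near p f" "holo_near p g"
  shows "holo_near p (\<lambda>z. f z * g z)"
proof -
  obtain S T where "open S" "p \<in> S" "holo_on f S" "open T" "p \<in> T" "holo_on g T"
    using assms unfolding holo_near_def by blast
  hence "open (S \<inter> T)" "p \<in> S \<inter> T" "holo_on (\<lambda>z. f z * g z) (S \<inter> T)"
    by (auto intro!: holo_on_mult elim: holo_on_subset)
  thus ?thesis unfolding holo_near_def by blast
qed

lemma germ_eq_iff: "germ p f = germ p g \<longleftrightarrow> (\<forall>\<^sub>F z in nhds p. f z = g z)"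
proof
  assume "germ p f = germ p g"
  moreover have "f \<in> germ p f" by (simp add: germ_def)
  ultimately show "\<forall>\<^sub>F z in nhds p. f z = g z" by (simp add: germ_def)
next
  assume *: "\<forall>\<^sub>F z in nhds p. f z = g z"
  show "germ p f = germ p g" unfolding germ_def
  proof (intro Collect_cong iffI)
    fix h assume "\<forall>\<^sub>F z in nhds p. h z = f z"
    with * show "\<forall>\<^sub>F z in nhds p. h z = g z" by eventually_elim simp
  next
    fix h assume "\<forall>\<^sub>F z in nhds p. h z = g z"
    with * show "\<forall>\<^sub>F z in nhds p. h z = f z" by eventually_elim simp
  qed
qed

lemma germ_add: "germ p f \<oplus>\<^bsub>germ_ring p\<^esub> germ p g = germ p (\<lambda>z. f z + g z)"
proof -
  have "(\<exists>a\<in>germ p f. \<exists>b\<in>germ p g. \<forall>\<^sub>F z in nhds p. h z = a z + b z)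
      \<longleftrightarrow> (\<forall>\<^sub>F z in nhds p. h z = f z + g z)" for h
  proof
    assume "\<exists>a\<in>germ p f. \<exists>b\<in>germ p g. \<forall>\<^sub>F z in nhds p. h z = a z + b z"
    then obtain a b where "\<forall>\<^sub>F z in nhds p. a z = f z" "\<forall>\<^sub>F z in nhds p. b z = g z"
      "\<forall>\<^sub>F z in nhds p. h z = a z + b z" unfolding germ_def by blast
    thus "\<forall>\<^sub>F z in nhds p. h z = f z + g z" by eventually_elim simp
  next
    assume *: "\<forall>\<^sub>F z in nhds p. h z = f z + g z"
    have "f \<in> germ p f" "g \<in> germ p g" by (simp_all add: germ_def)
    with * show "\<exists>a\<in>germ p f. \<exists>b\<in>germ p g. \<forall>\<^sub>F z in nhds p. h z = a z + b z" by blast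
  qed
  thus ?thesis by (simp add: germ_ring_def) (simp add: germ_def)
qed

lemma germ_mult: "germ p f \<otimes>\<^bsub>germ_ring p\<^esub> germ p g = germ p (\<lambda>z. f z * g z)"
proof -
  have "(\<exists>a\<in>germ p f. \<exists>b\<in>germ p g. \<forall>\<^sub>F z in nhds p. h z = a z * b z)
      \<longleftrightarrow> (\<forall>\<^sub>F z in nhds p. h z = f z * g z)" for h
  proof
    assume "\<exists>a\<in>germ p f. \<exists>b\<in>germ p g. \<forall>\<^sub>F z in nhds p. h z = a z * b z"
    then obtain a b where "\<forall>\<^sub>F z in nhds p. a z = f z" "\<forall>\<^sub>F z in nhds p. b z = g z"
      "\<forall>\<^sub>F z in nhds p. h z = a z * b z" unfolding germ_def by blast
    thus "\<forall>\<^sub>F z in nhds p. h z = f z * g z" by eventually_elim simp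
  next
    assume *: "\<forall>\<^sub>F z in nhds p. h z = f z * g z"
    have "f \<in> germ p f" "g \<in> germ p g" by (simp_all add: germ_def)
    with * show "\<exists>a\<in>germ p f. \<exists>b\<in>germ p g. \<forall>\<^sub>F z in nhds p. h z = a z * b z" by blast
  qed
  thus ?thesis by (simp add: germ_ring_def) (simp add: germ_def)
qed

lemma germ_zero: "\<zero>\<^bsub>germ_ring p\<^esub> = germ p (\<lambda>z. 0)"
  and germ_one: "\<one>\<^bsub>germ_ring p\<^esub> = germ p (\<lambda>z. 1)"
  and germ_carrier: "carrier (germ_ring p) = germ p ` {f. holo_near p f}"
  by (simp_all add: germ_ring_def)

lemma cring_germ_ring: "cring (germ_ring p)"
proof (rule cringI)
  show "abelian_group (germ_ring p)"
  proof (rule abelian_groupI)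
    fix x assume "x \<in> carrier (germ_ring p)"
    then obtain f where f: "holo_near p f" "x = germ p f" by (auto simp: germ_carrier)
    have "holo_near p (\<lambda>z. - f z)"
      using holo_near_mult[OF holo_near_const[of p "-1"] f(1)] by simp
    moreover have "germ p (\<lambda>z. - f z) \<oplus>\<^bsub>germ_ring p\<^esub> x = \<zero>\<^bsub>germ_ring p\<^esub>"
      by (simp add: f germ_add germ_zero)
    ultimately show "\<exists>y\<in>carrier (germ_ring p). y \<oplus>\<^bsub>germ_ring p\<^esub> x = \<zero>\<^bsub>germ_ring p\<^esub>"
      by (auto simp: germ_carrier)
  qed (auto simp: germ_carrier germ_add germ_zero holo_near_const add_ac
         intro!: imageI holo_near_add)
next
  show "Group.comm_monoid (germ_ring p)"
    by (rule comm_monoidI)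
       (auto simp: germ_carrier germ_mult germ_one holo_near_const mult_ac
         intro!: imageI holo_near_mult)
qed (auto simp: germ_carrier germ_add germ_mult algebra_simps)

lemma maximalideal_germ_max: "maximalideal (germ_max p) (germ_ring p)"
proof -
  interpret R: cring "germ_ring p" by (rule cring_germ_ring)
  have uminus: "\<ominus>\<^bsub>germ_ring p\<^esub> germ p f = germ p (\<lambda>z. - f z)" if "holo_near p f" for f
  proof -
    have "holo_near p (\<lambda>z. - f z)"
      using holo_near_mult[OF holo_near_const[of p "-1"] that] by simp
    with that show ?thesis
      by (intro R.minus_equality) (auto simp: germ_carrier germ_add germ_zero)
  qed
  have ideal: "ideal (germ_max p) (germ_ring p)"
  proof (rule idealI)
    show "ring (germ_ring p)" by (rule R.ring_axioms)
    show "subgroup (germ_max p) (add_monoid (germ_ring p))"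
    proof (rule R.add.subgroupI)
      show "germ_max p \<subseteq> carrier (germ_ring p)" by (auto simp: germ_max_def germ_carrier)
      show "germ_max p \<noteq> {}" using holo_near_const[of p 0] by (auto simp: germ_max_def)
      fix a assume "a \<in> germ_max p"
      then obtain f where f: "a = germ p f" "holo_near p f" "f p = 0" by (auto simp: germ_max_def)
      have "holo_near p (\<lambda>z. - f z)"
        using holo_near_mult[OF holo_near_const[of p "-1"] f(2)] by simp
      thus "\<ominus>\<^bsub>germ_ring p\<^esub> a \<in> germ_max p" using f by (auto simp: germ_max_def uminus)
    next
      fix a b assume "a \<in> germ_max p" "b \<in> germ_max p"
      thus "a \<oplus>\<^bsub>germ_ring p\<^esub> b \<in> germ_max p"
        by (auto simp: germ_max_def germ_add intro!: imageI holo_near_add)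
    qed
  qed (auto simp: germ_max_def germ_carrier germ_mult intro!: imageI holo_near_mult)
  show ?thesis
  proof (rule maximalidealI[OF ideal])
    show "carrier (germ_ring p) \<noteq> germ_max p"
    proof
      assume "carrier (germ_ring p) = germ_max p"
      hence "germ p (\<lambda>z. 1) \<in> germ_max p" using R.one_closed by (simp add: germ_one)
      then obtain f where "f p = 0" "germ p (\<lambda>z. 1) = germ p f"
        unfolding germ_max_def by blast
      thus False using eventually_nhds_x_imp_x[of "\<lambda>z. 1 = f z" p] by (simp add: germ_eq_iff)
    qed
  next
    fix J assume J: "ideal J (germ_ring p)" "germ_max p \<subseteq> J" "J \<subseteq> carrier (germ_ring p)"
    interpret J: ideal J "germ_ring p" by (rule J(1))
    show "J = germ_max p \<or> J = carrier (germ_ring p)"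
    proof (cases "J \<subseteq> germ_max p")
      case False
      then obtain x where x: "x \<in> J" "x \<notin> germ_max p" by blast
      then obtain f where f: "holo_near p f" "x = germ p f" using J(3) by (auto simp: germ_carrier)
      with x have nz: "f p \<noteq> 0" by (auto simp: germ_max_def)
      let ?g = "\<lambda>z. f p + - 1 * f z"
      have "holo_near p ?g" by (intro holo_near_add holo_near_mult holo_near_const f(1))
      hence "germ p ?g \<in> germ_max p" unfolding germ_max_def by (intro imageI) simp
      with J(2) have "germ p ?g \<oplus>\<^bsub>germ_ring p\<^esub> x \<in> J" using x(1) J.a_closed by blast
      hence "germ p (\<lambda>z. f p) \<in> J" by (simp add: f(2) germ_add)
      moreover have "germ p (\<lambda>z. inverse (f p)) \<in> carrier (germ_ring p)"
        by (auto simp: germ_carrier intro!: imageI holo_near_const)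
      ultimately have "germ p (\<lambda>z. inverse (f p)) \<otimes>\<^bsub>germ_ring p\<^esub> germ p (\<lambda>z. f p) \<in> J"
        by (rule J.I_l_closed)
      hence "\<one>\<^bsub>germ_ring p\<^esub> \<in> J" using nz by (simp add: germ_mult germ_one)
      thus ?thesis using J.one_imp_carrier by blast
    qed (use J in blast)
  qed
qed

end

theory Submission
  imports Defs "HOL-Complex_Analysis.Great_Picard" "HOL-Complex_Analysis.Complex_Singularities"
begin

text \<open>The proof compares the growth of iterates of an operator with the growth of the leading term of a
function at a fixed point.

Let \<open>w C\<^sub>g\<close> be a bounded weighted composition operator with \<open>g p = p\<close> and \<open>w p \<noteq> 0\<close>. It acts on
\<open>V\<^bsub>p,n\<^esub> / V\<^bsub>p,n+1\<^esub>\<close>, and for infinitely many \<open>n\<close> this is the full space of homogeneous polynomials of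
degree \<open>n\<close>, on which the action is substitution of the derivative of \<open>g\<close> at \<open>p\<close>, multiplied by \<open>w p\<close>. An
eigenvalue \<open>\<mu>\<close> of the derivative thus yields an eigenvalue \<open>w p * \<mu> ^ n\<close>, whose modulus cannot exceed the
norm of the operator; letting \<open>n\<close> grow within this infinite set gives \<open>\<bar>\<mu>\<bar> \<le> 1\<close> (\<open>cotangent_eigenvalue_le_1\<close>). Composing \<open>u C\<^sub>f\<close>
with the operators of the second hypothesis, one finds that none of the maps \<open>z \<mapsto> a U f(z)\<close> with
\<open>0 < a < 1\<close> and \<open>U \<in> SU(d)\<close> has a fixed point at which an eigenvalue of the derivative has modulus
greater than \<open>1\<close>. From here on only these maps matter.

If \<open>d \<ge> 2\<close>, then \<open>SU(d)\<close> is transitive on spheres, and each point \<open>q \<noteq> 0\<close> with \<open>\<bar>f q\<bar> > \<bar>q\<bar>\<close> is a fixed point of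
one of these maps. Suppose that \<open>f\<close> grows faster than linearly. Then some quotient \<open>\<bar>f z\<bar> / \<bar>z\<bar> powr m\<close> with
\<open>m > 1\<close> attains its maximum on a spherical shell at such a point \<open>q\<close> off the inner sphere. As in Jack's lemma, maximality
makes \<open>v \<mapsto> \<langle>v, q\<rangle>\<close> a left eigenvector of the derivative of \<open>a U f\<close> at \<open>q\<close>, with a real eigenvalue
\<open>\<ge> m\<close>: a contradiction (\<open>linear_growth_of_no_expanding_fixed_points\<close>). So \<open>f\<close> grows at most linearly
and is affine by Liouville's theorem.

If \<open>d = 1\<close>, no rotations are available, and the condition reads: \<open>f z = t z\<close> with \<open>t > 1\<close> implies
\<open>\<bar>f' z\<bar> \<le> t\<close>. Then the solutions of \<open>f z = t z\<close> move towards the origin as \<open>t\<close> increases, and for large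
\<open>t\<close> a given disc contains at most one of them. It follows that there is never more than one nonzero
solution, unless \<open>f\<close> is linear (\<open>unique_nonzero_ray_solution\<close>). The great Picard theorem, applied to \<open>f z / z\<close> at
infinity, then excludes transcendental \<open>f\<close>, and polynomials of degree \<open>\<ge> 2\<close> are excluded because
\<open>z f' z / f z\<close> tends to the degree at infinity (\<open>affine_of_contracting_ray_solutions\<close>).\<close>

section \<open>Solutions of \<open>f z = t z\<close> in one variable\<close>

text \<open>Near a critical point \<open>q\<close> one can write \<open>F z - F q = k z ^ n\<close> with \<open>n \<ge> 2\<close> and a local
coordinate \<open>k\<close>. Each nearby value other than \<open>F q\<close> is therefore taken at the points with
\<open>k z = a\<close> and \<open>k z = b\<close> for two different \<open>n\<close>-th roots \<open>a\<close> and \<open>b\<close>.\<close>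

lemma two_preimages_near_critical_point:
  fixes F :: "complex \<Rightarrow> complex"
  assumes hol: "F holomorphic_on S" and S: "open S" "connected S" "q \<in> S"
    and nc: "\<not> F constant_on S" and crit: "deriv F q = 0" and e: "e > 0"
  obtains d where "d > 0"
    "\<And>w. \<lbrakk>w \<noteq> 0; cmod w < d\<rbrakk> \<Longrightarrow>
       \<exists>x\<in>S \<inter> ball q e. \<exists>y\<in>S \<inter> ball q e. x \<noteq> y \<and> F x = F q + w \<and> F y = F q + w"
proof -
  have "(\<lambda>z. F z - F q) holomorphic_on S" by (intro holomorphic_intros hol)
  moreover have "\<not> (\<lambda>z. F z - F q) constant_on S"
    using nc by (auto simp: constant_on_def) (metis S(3) diff_add_cancel)
  ultimately obtain g r n where n: "0 < n" and r: "0 < r" "ball q r \<subseteq> S"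
    and g: "g holomorphic_on ball q r" "\<And>w. w \<in> ball q r \<Longrightarrow> F w - F q = (w - q)^n * g w"
      "\<And>w. w \<in> ball q r \<Longrightarrow> g w \<noteq> 0"
    using holomorphic_factor_zero_nonconstant[of "\<lambda>z. F z - F q" S q] S by (smt (verit) diff_self)
  have "n \<noteq> 1"
  proof
    assume n1: "n = 1"
    have gd: "(g has_field_derivative deriv g q) (at q)"
      using g(1) r by (intro holomorphic_derivI[of _ "ball q r"]) auto
    have "((\<lambda>w. F q + (w - q) * g w) has_field_derivative ((q - q) * deriv g q + 1 * g q)) (at q)"
      by (rule gd derivative_eq_intros | simp)+
    moreover have "\<forall>\<^sub>F w in nhds q. F w = F q + (w - q) * g w"
      using eventually_nhds_in_open[of "ball q r" q] r(1)
      by (rule_tac eventually_mono[where P="\<lambda>w. w \<in> ball q r"]) (use g(2) n1 in \<open>auto simp: algebra_simps\<close>)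
    ultimately have "(F has_field_derivative g q) (at q)"
      by (subst DERIV_cong_ev[OF refl _ refl]) auto
    with crit g(3)[of q] r(1) show False by (simp add: DERIV_imp_deriv)
  qed
  with n have n2: "n \<ge> 2" by simp
  obtain l where l: "l holomorphic_on ball q r" "\<And>w. w \<in> ball q r \<Longrightarrow> g w = exp (l w)"
    using contractible_imp_holomorphic_log[OF g(1) _ g(3)]
    by (metis convex_ball convex_imp_contractible)
  define k where "k = (\<lambda>w. (w - q) * exp (l w / n))"
  have kn: "F w - F q = k w ^ n" if "w \<in> ball q r" for w
    using n that g(2) l(2) by (simp add: k_def power_mult_distrib flip: exp_of_nat_mult)
  define r' where "r' = min r e"
  have r': "r' > 0" "ball q r' \<subseteq> ball q r" using r e by (auto simp: r'_def)
  have hk: "k holomorphic_on ball q r'"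
    unfolding k_def using n r' by (intro holomorphic_intros holomorphic_on_subset[OF l(1)]) auto
  have ld: "(l has_field_derivative deriv l q) (at q)"
    using l(1) r by (intro holomorphic_derivI[of _ "ball q r"]) auto
  have "(k has_field_derivative exp (l q / n)) (at q)"
    unfolding k_def using n by (auto intro!: derivative_eq_intros ld)
  hence "deriv k q \<noteq> 0" by (simp add: DERIV_imp_deriv)
  from has_complex_derivative_locally_invertible[OF hk _ _ this] r' obtain s where s: "s > 0"
    "ball q s \<subseteq> ball q r'" "open (k ` ball q s)" by (metis centre_in_ball open_ball)
  have "k q = 0" by (simp add: k_def)
  with s(1) have "0 \<in> k ` ball q s" by (metis centre_in_ball image_eqI)
  with s(3) obtain \<rho> where \<rho>: "\<rho> > 0" "ball 0 \<rho> \<subseteq> k ` ball q s"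
    using openE by blast
  show ?thesis
  proof (rule that[of "\<rho> ^ n"])
    show "0 < \<rho> ^ n" using \<rho> by simp
    fix w :: complex assume w: "w \<noteq> 0" "cmod w < \<rho> ^ n"
    define a where "a = exp (Ln w / n)"
    define b where "b = a * exp (2 * of_real pi * \<i> * (of_nat 1 / of_nat n))"
    have an: "a ^ n = w" using w n by (simp add: a_def flip: exp_of_nat_mult)
    have "exp (2 * of_real pi * \<i> * (of_nat 1 / of_nat n)) ^ n = 1"
      using n complex_root_unity[of n 1] by auto
    hence bn: "b ^ n = w" by (simp add: b_def power_mult_distrib an)
    have "exp (2 * of_real pi * \<i> * (of_nat 1 / of_nat n)) \<noteq> exp (2 * of_real pi * \<i> * (of_nat 0 / of_nat n))"
      using n2 complex_root_unity_eq[of n 1 0] n by auto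
    hence ab: "a \<noteq> b" by (auto simp: b_def a_def)
    have na: "x \<in> ball 0 \<rho>" if "x ^ n = w" for x
    proof -
      have "cmod x ^ n < \<rho> ^ n" using w that by (simp flip: norm_power)
      thus ?thesis using power_less_imp_less_base \<rho>(1) by (metis dist_0_norm less_eq_real_def mem_ball)
    qed
    have "a \<in> k ` ball q s" "b \<in> k ` ball q s"
      using na[OF an] na[OF bn] \<rho>(2) by (blast, blast)
    then obtain x y where xy: "x \<in> ball q s" "k x = a" "y \<in> ball q s" "k y = b"
      by (elim imageE) auto
    have "ball q s \<subseteq> ball q r" "ball q s \<subseteq> ball q e" "ball q s \<subseteq> S"
      using s r' r by (auto simp: r'_def subset_iff)
    moreover have "F x = F q + w" "F y = F q + w"
      using kn[of x] kn[of y] xy an bn \<open>ball q s \<subseteq> ball q r\<close> by (auto simp: algebra_simps)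
    moreover have "x \<noteq> y" using xy ab by auto
    ultimately show "\<exists>x\<in>S \<inter> ball q e. \<exists>y\<in>S \<inter> ball q e. x \<noteq> y \<and> F x = F q + w \<and> F y = F q + w"
      using xy by blast
  qed
qed

text \<open>Follow the local inverse \<open>c\<close> of \<open>F\<close> along the real direction: \<open>c 0 = q\<close> and \<open>c' 0 = 1 / F' q\<close>,
so \<open>\<bar>c s\<bar>\<^sup>2\<close> has derivative \<open>2 Re (cnj q / F' q) < 0\<close> at \<open>s = 0\<close>, and the preimage of \<open>F q + s\<close>
moves strictly towards the origin.\<close>

lemma preimage_closer_to_origin:
  fixes F :: "complex \<Rightarrow> complex"
  assumes hol: "F holomorphic_on S" and S: "open S" "q \<in> S"
    and nz: "deriv F q \<noteq> 0" and dir: "Re (cnj q / deriv F q) < 0" and e: "e > 0"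
  obtains d where "d > 0"
    "\<And>s. \<lbrakk>0 < s; s < d\<rbrakk> \<Longrightarrow> \<exists>z\<in>S \<inter> ball q e. cmod z < cmod q \<and> F z = F q + of_real s"
proof -
  have "open (S \<inter> ball q e)" "q \<in> S \<inter> ball q e" using S e by auto
  moreover have "F holomorphic_on S \<inter> ball q e" using hol holomorphic_on_subset by blast
  ultimately obtain r where r: "r > 0" "ball q r \<subseteq> S \<inter> ball q e" "open (F ` ball q r)" "inj_on F (ball q r)"
    using has_complex_derivative_locally_invertible[of F "S \<inter> ball q e" q] nz by metis
  have Fr: "F holomorphic_on ball q r" using hol r(2) holomorphic_on_subset by blast
  obtain g where g: "g holomorphic_on F ` ball q r"
    "\<And>z. z \<in> ball q r \<Longrightarrow> deriv F z * deriv g (F z) = 1" "\<And>z. z \<in> ball q r \<Longrightarrow> g (F z) = z"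
    using holomorphic_has_inverse[OF Fr open_ball r(4)] by metis
  have qr: "q \<in> ball q r" using r by simp
  have gd: "(g has_field_derivative (1 / deriv F q)) (at (F q))"
    using holomorphic_derivI[OF g(1) r(3)] g(2)[OF qr] qr nz by (metis eq_divide_imp imageI mult.commute)
  define c where "c = (\<lambda>s::real. g (F q + of_real s))"
  have "(c has_vector_derivative (1 / deriv F q)) (at 0)"
  proof -
    have "((\<lambda>s::real. F q + of_real s) has_vector_derivative 1) (at 0)"
      by (auto intro!: derivative_eq_intros simp: has_vector_derivative_def scaleR_conv_of_real)
    from field_vector_diff_chain_at[OF this, of g "1 / deriv F q"] gd
    show ?thesis by (simp add: c_def o_def)
  qed
  hence cd: "(c has_derivative (\<lambda>s. s *\<^sub>R (1 / deriv F q))) (at 0)" by (simp add: has_vector_derivative_def)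
  have c0: "c 0 = q" using g(3)[OF qr] by (simp add: c_def)
  have "((\<lambda>s. c s \<bullet> c s) has_real_derivative 2 * Re (cnj q / deriv F q)) (at 0)"
    unfolding has_field_derivative_def
    by (rule has_derivative_eq_rhs[OF has_derivative_inner[OF cd cd]])
       (simp add: c0 fun_eq_iff inner_complex_def divide_inverse algebra_simps)
  from DERIV_neg_dec_right[OF this] dir obtain d where d: "d > 0"
    "\<And>h. 0 < h \<Longrightarrow> h < d \<Longrightarrow> c h \<bullet> c h < q \<bullet> q" by (auto simp: c0)
  have "F q \<in> F ` ball q r" using qr by blast
  then obtain \<rho> where \<rho>: "\<rho> > 0" "ball (F q) \<rho> \<subseteq> F ` ball q r" using r(3) openE by blast
  show ?thesis
  proof (rule that[of "min d \<rho>"])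
    show "0 < min d \<rho>" using d \<rho> by simp
    fix s assume s: "0 < s" "s < min d \<rho>"
    have "F q + of_real s \<in> ball (F q) \<rho>" using s by (simp add: dist_norm)
    then obtain z where z: "z \<in> ball q r" "F q + of_real s = F z" using \<rho>(2) by blast
    hence "c s = z" using g(3) by (simp add: c_def)
    hence "cmod z < cmod q" using d(2)[of s] s by (simp add: norm_eq_sqrt_inner)
    thus "\<exists>z\<in>S \<inter> ball q e. cmod z < cmod q \<and> F z = F q + of_real s"
      using z r(2) by (intro bexI[of _ z]) auto
  qed
qed

text \<open>The nonzero solutions of \<open>f z = t z\<close> are the preimages of \<open>t\<close> under \<open>F z = f z / z\<close>. Along a curve of
such solutions \<open>\<bar>z\<bar>\<close> decreases as \<open>t\<close> grows: \<open>z F' z = f' z - t\<close>, and \<open>\<bar>f' z\<bar> \<le> t\<close> puts \<open>f' z - t\<close>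
into the disc of radius \<open>t\<close> about \<open>- t\<close>, hence into the left half plane. So two different solutions in a
disc can both be continued inside that disc to a larger \<open>t\<close>. This cannot go on, since \<open>t\<close> is bounded
by the Lipschitz constant of \<open>f\<close> on the disc: \<open>f x - f y = t (x - y)\<close>. The two curves cannot be
stopped by a collision either, because from a critical point of \<open>F\<close> two new solutions branch off.\<close>

lemma unique_nonzero_ray_solution:
  fixes f :: "complex \<Rightarrow> complex"
  assumes hol: "f holomorphic_on UNIV" and nonlin: "\<not> (\<exists>a. \<forall>z. f z = a * z)"
    and bd: "\<And>t z. \<lbrakk>t > 1; f z = of_real t * z\<rbrakk> \<Longrightarrow> cmod (deriv f z) \<le> t"
    and t: "t > 1" and xy: "x \<noteq> 0" "y \<noteq> 0" "f x = of_real t * x" "f y = of_real t * y"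
  shows "x = y"
proof (rule ccontr)
  assume "x \<noteq> y"
  define S :: "complex set" where "S = UNIV - {0}"
  define F where "F = (\<lambda>z. f z / z)"
  have S: "open S" "connected S" unfolding S_def
    by (auto intro!: open_delete connected_punctured_universe simp: Compl_eq_Diff_UNIV[symmetric])
  have zS [simp]: "z \<in> S \<longleftrightarrow> z \<noteq> 0" for z by (simp add: S_def)
  have F: "F holomorphic_on S" unfolding F_def S_def
    by (intro holomorphic_intros holomorphic_on_subset[OF hol]) auto
  have fd: "(f has_field_derivative deriv f z) (at z)" for z
    using hol by (intro holomorphic_derivI[of _ UNIV]) auto
  have dF: "deriv F z = (deriv f z - F z) / z" if "z \<noteq> 0" for z
  proof (rule DERIV_imp_deriv)
    show "(F has_field_derivative (deriv f z - F z) / z) (at z)"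
      unfolding F_def using that
      by (auto intro!: derivative_eq_intros fd simp: field_simps power2_eq_square)
  qed
  have F_iff: "F z = of_real s \<longleftrightarrow> f z = of_real s * z" if "z \<noteq> 0" for z s
    using that by (simp add: F_def field_simps)
  have nc: "\<not> F constant_on S"
  proof
    assume "F constant_on S"
    then obtain a where a: "\<And>z. z \<noteq> 0 \<Longrightarrow> f z = a * z"
      by (auto simp: constant_on_def F_def field_simps)
    have "f \<midarrow>0\<rightarrow> f 0" using fd[of 0] DERIV_isCont isContD by blast
    moreover have "f \<midarrow>0\<rightarrow> a * 0"
    proof (rule Lim_transform_eventually)
      show "(\<lambda>z. a * z) \<midarrow>0\<rightarrow> a * 0" by (intro tendsto_intros)
      show "\<forall>\<^sub>F z in at 0. a * z = f z" by (simp add: a eventually_at_filter)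
    qed
    ultimately have "f 0 = a * 0" by (rule LIM_unique)
    with a nonlin show False by metis
  qed
  have cnt: "countable {z\<in>S. deriv F z = 0}"
  proof -
    define D where "D = (\<lambda>z. z * deriv f z - f z)"
    have D: "D holomorphic_on UNIV" unfolding D_def
      using hol holomorphic_deriv[OF hol open_UNIV] by (auto intro!: holomorphic_intros)
    have DF: "deriv F z = 0 \<longleftrightarrow> D z = 0" if "z \<noteq> 0" for z
      using dF[OF that] that by (auto simp: D_def F_def field_simps)
    show ?thesis
    proof (cases "D constant_on UNIV")
      case False
      have "countable {z\<in>UNIV. D z = 0}"
        by (rule holomorphic_countable_zeros[OF D _ _ _ False]) auto
      thus ?thesis by (rule countable_subset[rotated]) (auto simp: DF)
    next
      case True
      then obtain c where c: "\<And>z. D z = c" by (auto simp: constant_on_def)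
      have "c \<noteq> 0"
      proof
        assume "c = 0"
        hence "deriv F z = 0" if "z \<in> S" for z using c DF that by simp
        hence "F constant_on S"
          using has_field_derivative_0_imp_constant_on[of S F] F S by (metis holomorphic_derivI)
        with nc show False by simp
      qed
      hence "{z\<in>S. deriv F z = 0} = {}" using c DF by auto
      thus ?thesis using countable_empty by metis
    qed
  qed
  \<comment> \<open>On the boundary of the disc one can continue inwards only where \<open>F\<close> is not critical,
    so its radius avoids the countably many moduli of critical points.\<close>
  obtain R where R: "R > max (cmod x) (cmod y)" "\<And>z. \<lbrakk>z \<noteq> 0; cmod z = R\<rbrakk> \<Longrightarrow> deriv F z \<noteq> 0"
  proof -
    let ?m = "max (cmod x) (cmod y)"
    have "uncountable {?m <..< ?m + 1}" by (simp add: uncountable_open_interval)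
    moreover have "countable (cmod ` {z\<in>S. deriv F z = 0})" using cnt by simp
    ultimately have "\<not> {?m <..< ?m + 1} \<subseteq> cmod ` {z\<in>S. deriv F z = 0}"
      using countable_subset by metis
    then obtain R where "R \<in> {?m <..< ?m + 1}" "R \<notin> cmod ` {z\<in>S. deriv F z = 0}"
      by (meson subsetI)
    thus thesis by (intro that[of R]) auto
  qed
  obtain B where B: "\<And>a b. \<lbrakk>a \<in> cball 0 R; b \<in> cball 0 R\<rbrakk> \<Longrightarrow> cmod (f a - f b) \<le> B * cmod (a - b)"
  proof -
    have "continuous_on (cball 0 R) (deriv f)"
      using holomorphic_deriv[OF hol open_UNIV] by (meson continuous_on_subset holomorphic_on_imp_continuous_on subset_UNIV)
    hence "bounded (deriv f ` cball 0 R)" by (intro compact_imp_bounded compact_continuous_image) auto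
    then obtain B where B: "\<And>z. z \<in> cball 0 R \<Longrightarrow> cmod (deriv f z) \<le> B"
      unfolding bounded_iff by blast
    show thesis
      by (rule that, rule field_differentiable_bound[of "cball 0 R" f "deriv f"])
         (auto intro: B has_field_derivative_at_within fd)
  qed
  define A where "A = {(s, a, b). t \<le> s \<and> a \<noteq> b \<and> a \<noteq> 0 \<and> b \<noteq> 0 \<and> cmod a \<le> R \<and> cmod b \<le> R
                         \<and> f a = of_real s * a \<and> f b = of_real s * b}"
  have sB: "s \<le> B" if "(s, a, b) \<in> A" for s a b
  proof -
    have *: "cmod (f a - f b) \<le> B * cmod (a - b)" using that by (intro B) (auto simp: A_def)
    have "f a - f b = of_real s * (a - b)" using that by (auto simp: A_def algebra_simps)
    hence "s * cmod (a - b) \<le> B * cmod (a - b)" using * that t by (auto simp: A_def norm_mult)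
    thus ?thesis using that by (auto simp: A_def)
  qed
  have Asub: "A \<subseteq> {t..B} \<times> cball 0 R \<times> cball 0 R"
    using sB by (auto simp: A_def)
  \<comment> \<open>The largest \<open>s\<close> for which a pair of solutions exists is taken over the closure of \<open>A\<close>, where
    the two solutions may coincide.\<close>
  have "bounded ({t..B} \<times> cball (0::complex) R \<times> cball (0::complex) R)"
    by (intro bounded_Times bounded_closed_interval bounded_cball)
  hence "compact (closure A)" using Asub bounded_subset compact_closure by blast
  moreover have "(t, x, y) \<in> A" using \<open>x \<noteq> y\<close> xy R(1) by (simp add: A_def)
  hence "closure A \<noteq> {}" using closure_subset by blast
  ultimately obtain p where p: "p \<in> closure A" "\<And>p'. p' \<in> closure A \<Longrightarrow> fst p' \<le> fst p"
    using continuous_attains_sup[of "closure A" fst] continuous_on_fst[OF continuous_on_id] by metis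
  obtain s a b where sab: "p = (s, a, b)" by (cases p)
  obtain P where P: "\<And>n. P n \<in> A" "P \<longlonglongrightarrow> (s, a, b)"
    using p(1) unfolding closure_sequential sab by blast
  define sn an bn where defs: "sn = (\<lambda>n. fst (P n))" "an = (\<lambda>n. fst (snd (P n)))" "bn = (\<lambda>n. snd (snd (P n)))"
  have lim: "sn \<longlonglongrightarrow> s" "an \<longlonglongrightarrow> a" "bn \<longlonglongrightarrow> b"
    using tendsto_fst[OF P(2)] tendsto_fst[OF tendsto_snd[OF P(2)]] tendsto_snd[OF tendsto_snd[OF P(2)]]
    by (simp_all add: defs)
  have PA: "(sn n, an n, bn n) \<in> A" for n using P(1)[of n] by (simp add: defs)
  have PA': "t \<le> sn n" "an n \<noteq> bn n" "an n \<noteq> 0" "bn n \<noteq> 0" "cmod (an n) \<le> R" "cmod (bn n) \<le> R"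
    "f (an n) = of_real (sn n) * an n" "f (bn n) = of_real (sn n) * bn n" for n
    using PA[of n] by (auto simp: A_def)
  have s1: "s \<ge> t" using LIMSEQ_le_const[OF lim(1)] PA'(1) by blast
  \<comment> \<open>A limit of nonzero solutions is nonzero: otherwise \<open>f 0 = 0\<close> and \<open>f' 0 = s\<close>, whereas \<open>0\<close> solves
    \<open>f z = t' z\<close> for all \<open>t' > 1\<close>, which forces \<open>\<bar>f' 0\<bar> \<le> 1 < s\<close>.\<close>
  have key: "f c = of_real s * c \<and> c \<noteq> 0 \<and> cmod c \<le> R"
    if c: "cn \<longlonglongrightarrow> c" "\<And>n. cn n \<noteq> 0" "\<And>n. f (cn n) = of_real (sn n) * cn n" "\<And>n. cmod (cn n) \<le> R"
    for cn c
  proof -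
    have "(\<lambda>n. f (cn n)) \<longlonglongrightarrow> f c"
      using isCont_tendsto_compose[OF _ c(1), of f] fd[of c] DERIV_isCont by blast
    moreover have "(\<lambda>n. f (cn n)) \<longlonglongrightarrow> of_real s * c"
      using c(1) lim(1) by (simp add: c(3)) (intro tendsto_intros)
    ultimately have fc: "f c = of_real s * c" using LIMSEQ_unique by blast
    have "c \<noteq> 0"
    proof
      assume c0: "c = 0"
      with fc have f0: "f 0 = 0" by simp
      have "((\<lambda>h. f h / h) \<longlongrightarrow> deriv f 0) (at 0)" using fd[of 0] by (simp add: DERIV_def f0)
      moreover have "filterlim cn (at 0) sequentially"
        using c(1,2) c0 by (auto simp: filterlim_at)
      ultimately have "(\<lambda>n. f (cn n) / cn n) \<longlonglongrightarrow> deriv f 0"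
        by (rule filterlim_compose)
      moreover have "(\<lambda>n. f (cn n) / cn n) = (\<lambda>n. of_real (sn n))" using c(2,3) by auto
      moreover have "(\<lambda>n. complex_of_real (sn n)) \<longlonglongrightarrow> of_real s" using lim(1) by (intro tendsto_intros)
      ultimately have "deriv f 0 = of_real s" using LIMSEQ_unique by metis
      moreover have "cmod (deriv f 0) \<le> (1 + t) / 2" using t f0 by (intro bd) auto
      ultimately show False using s1 t by simp
    qed
    moreover have "cmod c \<le> R" using Lim_bounded[OF tendsto_norm[OF c(1)]] c(4) by blast
    ultimately show ?thesis using fc by blast
  qed
  have a: "f a = of_real s * a" "a \<noteq> 0" "cmod a \<le> R" using key[OF lim(2)] PA' by auto
  have b: "f b = of_real s * b" "b \<noteq> 0" "cmod b \<le> R" using key[OF lim(3)] PA' by auto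
  have contra: False if "s' > s" "a' \<noteq> b'" "a' \<noteq> 0" "b' \<noteq> 0" "cmod a' \<le> R" "cmod b' \<le> R"
    "F a' = of_real s'" "F b' = of_real s'" for s' a' b'
  proof -
    have "(s', a', b') \<in> A" using that s1 F_iff by (auto simp: A_def)
    hence "(s', a', b') \<in> closure A" using closure_subset by blast
    from p(2)[OF this] that(1) show False by (simp add: sab)
  qed
  \<comment> \<open>Each limit solution persists near by, within the disc, for all slightly larger values of \<open>s\<close>.\<close>
  have cont: "\<exists>d>0. \<forall>h. 0 < h \<longrightarrow> h < d \<longrightarrow> (\<exists>z\<in>ball c e. z \<noteq> 0 \<and> cmod z \<le> R \<and> F z = of_real (s + h))"
    if c: "f c = of_real s * c" "c \<noteq> 0" "cmod c \<le> R" and e: "e > 0" for c e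
  proof -
    have Fc: "F c = of_real s" using c F_iff by simp
    show ?thesis
    proof (cases "cmod c < R")
      case True
      define U where "U = S \<inter> ball c e \<inter> ball 0 R"
      have "open (F ` U)"
        by (rule open_mapping_thm[OF F S _ _ nc]) (use S(1) in \<open>auto simp: U_def\<close>)
      moreover have "of_real s \<in> F ` U" using c e True Fc by (intro image_eqI[of _ _ c]) (auto simp: U_def)
      ultimately obtain d where d: "d > 0" "ball (of_real s) d \<subseteq> F ` U" using openE by blast
      have "\<exists>z\<in>ball c e. z \<noteq> 0 \<and> cmod z \<le> R \<and> F z = of_real (s + h)" if "0 < h" "h < d" for h
      proof -
        have "of_real (s + h) \<in> ball (complex_of_real s) d" using that by (simp add: dist_norm)
        then obtain z where "z \<in> U" "F z = of_real (s + h)" using d(2) by (metis (no_types, lifting) image_iff subsetD)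
        thus ?thesis by (auto simp: U_def)
      qed
      thus ?thesis using d(1) by blast
    next
      case False
      hence "deriv F c \<noteq> 0" using R(2) c by simp
      have "Re (cnj c / deriv F c) < 0"
      proof -
        define w where "w = deriv f c - of_real s"
        have w0: "w \<noteq> 0" using \<open>deriv F c \<noteq> 0\<close> dF[OF c(2)] Fc by (auto simp: w_def)
        have "cmod (of_real s + w) \<le> s" using bd[OF _ c(1)] s1 t by (simp add: w_def)
        hence "(cmod (of_real s + w))\<^sup>2 \<le> s\<^sup>2" by (rule power_mono) simp
        hence "2 * s * Re w + (cmod w)\<^sup>2 \<le> 0"
          unfolding cmod_power2 by (simp add: power2_eq_square algebra_simps)
        moreover have "(cmod w)\<^sup>2 > 0" using w0 by simp
        ultimately have "s * Re w < 0" by linarith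
        hence "Re w < 0" using s1 t by (simp add: mult_less_0_iff)
        have "cnj c / deriv F c = of_real ((cmod c)\<^sup>2) / w"
          using dF[OF c(2)] Fc complex_norm_square[of c] by (simp add: w_def mult.commute)
        also have "Re \<dots> = (cmod c)\<^sup>2 * Re w / (cmod w)\<^sup>2"
          by (simp add: Re_divide cmod_power2)
        also have "\<dots> < 0" using \<open>Re w < 0\<close> w0 c(2) by (intro divide_neg_pos mult_pos_neg) auto
        finally show ?thesis .
      qed
      from preimage_closer_to_origin[OF F S(1) _ \<open>deriv F c \<noteq> 0\<close> this e] c(2) obtain d where "d > 0"
        "\<And>h. \<lbrakk>0 < h; h < d\<rbrakk> \<Longrightarrow> \<exists>z\<in>S \<inter> ball c e. cmod z < cmod c \<and> F z = F c + of_real h" by (metis zS)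
      thus ?thesis using Fc c(3) by (intro exI[of _ d]) fastforce
    qed
  qed
  show False
  proof (cases "a = b")
    case False
    define e where "e = dist a b / 2"
    have e: "e > 0" using False by (simp add: e_def)
    obtain d1 where d1: "d1 > 0"
      "\<And>h. \<lbrakk>0 < h; h < d1\<rbrakk> \<Longrightarrow> \<exists>z\<in>ball a e. z \<noteq> 0 \<and> cmod z \<le> R \<and> F z = of_real (s + h)"
      using cont[OF a e] by blast
    obtain d2 where d2: "d2 > 0"
      "\<And>h. \<lbrakk>0 < h; h < d2\<rbrakk> \<Longrightarrow> \<exists>z\<in>ball b e. z \<noteq> 0 \<and> cmod z \<le> R \<and> F z = of_real (s + h)"
      using cont[OF b e] by blast
    define h where "h = min d1 d2 / 2"
    have h: "0 < h" "h < d1" "h < d2" using d1(1) d2(1) by (auto simp: h_def)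
    obtain a' where a': "a' \<in> ball a e" "a' \<noteq> 0" "cmod a' \<le> R" "F a' = of_real (s + h)"
      using d1(2) h by blast
    obtain b' where b': "b' \<in> ball b e" "b' \<noteq> 0" "cmod b' \<le> R" "F b' = of_real (s + h)"
      using d2(2) h by blast
    have "a' \<noteq> b'"
    proof
      assume "a' = b'"
      hence "dist a b < e + e" using a'(1) b'(1) dist_triangle_less_add[of a a' e b e] by (simp add: dist_commute)
      thus False by (simp add: e_def)
    qed
    thus False using contra[of "s + h" a' b'] a' b' h by auto
  next
    case True
    \<comment> \<open>Different solutions for the same parameter have collided at \<open>a\<close>, so \<open>F\<close> is not injective there.\<close>
    have crit: "deriv F a = 0"
    proof (rule ccontr)
      assume "deriv F a \<noteq> 0"
      then obtain r where r: "r > 0" "inj_on F (ball a r)"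
        using has_complex_derivative_locally_injective[OF F _ S(1)] a(2) by (metis zS)
      have "\<forall>\<^sub>F n in sequentially. an n \<in> ball a r" "\<forall>\<^sub>F n in sequentially. bn n \<in> ball a r"
        using topological_tendstoD[OF lim(2), of "ball a r"] topological_tendstoD[OF lim(3), of "ball a r"]
          True r(1) by (simp_all del: mem_ball add: centre_in_ball)
      hence "\<forall>\<^sub>F n in sequentially. False"
      proof eventually_elim
        case (elim n)
        moreover have "F (an n) = F (bn n)" using PA'[of n] by (simp add: F_def)
        ultimately show False using r(2) PA'(2)[of n] by (auto dest: inj_onD)
      qed
      thus False by simp
    qed
    hence aR: "cmod a < R" using R(2)[OF a(2)] a(3) by fastforce
    obtain d where d: "d > 0" "\<And>w. \<lbrakk>w \<noteq> 0; cmod w < d\<rbrakk> \<Longrightarrow>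
       \<exists>x\<in>S \<inter> ball a (R - cmod a). \<exists>y\<in>S \<inter> ball a (R - cmod a). x \<noteq> y \<and> F x = F a + w \<and> F y = F a + w"
      using two_preimages_near_critical_point[OF F S _ nc crit, of "R - cmod a"] a(2) aR by (metis diff_gt_0_iff_gt zS)
    obtain a' b' where ab: "a' \<in> S \<inter> ball a (R - cmod a)" "b' \<in> S \<inter> ball a (R - cmod a)" "a' \<noteq> b'"
      "F a' = F a + of_real (d/2)" "F b' = F a + of_real (d/2)"
      using d(2)[of "of_real (d/2)"] d(1) by auto
    have "cmod z \<le> R" if "z \<in> S \<inter> ball a (R - cmod a)" for z
    proof -
      have "cmod z \<le> cmod a + cmod (z - a)" using norm_triangle_ineq[of a "z - a"] by simp
      thus ?thesis using that by (simp add: dist_norm norm_minus_commute)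
    qed
    moreover have "F a = of_real s" using a F_iff by simp
    ultimately show False using contra[of "s + d/2" a' b'] ab d(1) by auto
  qed
qed

text \<open>In the coordinate \<open>w = 1 / z\<close> at infinity, \<open>f z / z\<close> becomes \<open>G w = w f (1 / w)\<close>. By the great
Picard theorem an essential singularity of \<open>G\<close> at \<open>0\<close> would produce infinitely many solutions of
\<open>f z = t z\<close> for \<open>t = 2\<close> or \<open>t = 3\<close>, against uniqueness. A finite limit means that \<open>f\<close> grows at most
linearly, so \<open>f\<close> is affine by Liouville. If \<open>G\<close> has a pole of order \<open>n > 0\<close>, then \<open>z f' z / f z\<close> tends
to \<open>n + 1 \<ge> 2\<close> at infinity, while \<open>f z = t z\<close> has solutions arbitrarily far out for large \<open>t\<close>, where
the hypothesis says \<open>\<bar>z f' z / f z\<bar> \<le> 1\<close>.\<close>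

lemma affine_of_contracting_ray_solutions:
  fixes f :: "complex \<Rightarrow> complex"
  assumes hol: "f holomorphic_on UNIV"
    and bd: "\<And>t z. \<lbrakk>t > 1; f z = of_real t * z\<rbrakk> \<Longrightarrow> cmod (deriv f z) \<le> t"
  shows "\<exists>a b. \<forall>z. f z = a * z + b"
proof (rule ccontr)
  assume naff: "\<nexists>a b. \<forall>z. f z = a * z + b"
  have nonlin: "\<not> (\<exists>a. \<forall>z. f z = a * z)"
  proof
    assume "\<exists>a. \<forall>z. f z = a * z"
    then obtain a where "\<forall>z. f z = a * z + 0" by auto
    with naff show False by blast
  qed
  have fd: "(f has_field_derivative deriv f z) (at z)" for z
    using hol by (intro holomorphic_derivI[of _ UNIV]) auto
  define G where "G = (\<lambda>w. w * f (inverse w))"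
  have G: "G holomorphic_on UNIV - {0}"
  proof -
    have "(f \<circ> inverse) holomorphic_on UNIV - {0}"
      by (rule holomorphic_on_compose_gen[OF _ hol]) (auto intro!: holomorphic_intros)
    thus ?thesis unfolding G_def by (intro holomorphic_intros) (simp add: o_def)
  qed
  have Gf: "f (inverse w) = G w * inverse w" if "w \<noteq> 0" for w using that by (simp add: G_def)
  have no_finite_limit: "\<not> (G \<longlongrightarrow> l) (at 0)" for l
  proof
    assume "(G \<longlongrightarrow> l) (at 0)"
    hence "\<forall>\<^sub>F w in at 0. cmod (G w) < cmod l + 1"
      by (intro order_tendstoD[OF tendsto_norm]) auto
    then obtain d where d: "d > 0" "\<And>w. \<lbrakk>w \<noteq> 0; cmod w < d\<rbrakk> \<Longrightarrow> cmod (G w) < cmod l + 1"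
      by (auto simp: eventually_at)
    have expand: "f z = (\<Sum>k\<le>1. (deriv ^^ k) f 0 / fact k * z ^ k)" for z
    proof (rule Liouville_polynomial[OF hol])
      fix z :: complex assume z: "2 / d \<le> cmod z"
      hence "z \<noteq> 0" using d(1) by auto
      have "1 < d * cmod z" using z d(1) by (simp add: field_simps)
      hence "cmod (inverse z) < d" using \<open>z \<noteq> 0\<close> by (simp add: norm_inverse norm_divide field_simps)
      hence "cmod (G (inverse z)) < cmod l + 1" using d(2) \<open>z \<noteq> 0\<close> by simp
      moreover have "f z = G (inverse z) * z" using Gf[of "inverse z"] \<open>z \<noteq> 0\<close> by simp
      ultimately show "cmod (f z) \<le> (cmod l + 1) * cmod z ^ 1"
        by (simp add: norm_mult mult_right_mono)
    qed
    have "\<forall>z. f z = deriv f 0 * z + f 0" by (intro allI, subst expand) simp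
    with naff show False by blast
  qed
  have no_pole: "\<not> ((inverse \<circ> G) \<longlongrightarrow> 0) (at 0)"
  proof
    assume lim: "((inverse \<circ> G) \<longlongrightarrow> 0) (at 0)"
    hence "\<forall>\<^sub>F w in at 0. cmod ((inverse \<circ> G) w) < 1"
      by (intro order_tendstoD(2)[OF tendsto_norm[OF lim]]) simp
    then obtain d where d: "d > 0" "\<And>w. \<lbrakk>w \<noteq> 0; cmod w < d\<rbrakk> \<Longrightarrow> cmod (inverse (G w)) < 1"
      by (auto simp: eventually_at)
    \<comment> \<open>Because \<open>inverse 0 = 0\<close>, the limit does not exclude zeros of \<open>G\<close> at once; but near an isolated zero
      the inverse of \<open>G\<close> would be large.\<close>
    have Gnz: "G w0 \<noteq> 0" if w0: "w0 \<noteq> 0" "cmod w0 < d" for w0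
    proof
      assume G0: "G w0 = 0"
      have "\<exists>\<beta>\<in>UNIV - {0}. G \<beta> \<noteq> 0"
      proof (rule ccontr)
        assume "\<not> ?thesis"
        hence "(G \<longlongrightarrow> 0) (at 0)" by (intro tendsto_eventually) (auto simp: eventually_at_filter)
        thus False using no_finite_limit by blast
      qed
      then obtain \<beta> where \<beta>: "\<beta> \<in> UNIV - {0}" "G \<beta> \<noteq> 0" by blast
      have S: "open (UNIV - {0::complex})" "connected (UNIV - {0::complex})"
        by (auto intro!: open_delete connected_punctured_universe simp: Compl_eq_Diff_UNIV[symmetric])
      obtain r where r: "r > 0" "\<And>z. z \<in> ball w0 r - {w0} \<Longrightarrow> G z \<noteq> 0"
        using isolated_zeros[OF G S _ G0 \<beta>] w0(1) by (metis Diff_iff UNIV_I singletonD)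
      have "isCont G w0"
        using G S(1) w0(1) by (metis Diff_iff UNIV_I continuous_on_interior holomorphic_on_imp_continuous_on interior_open singletonD)
      hence "\<forall>\<^sub>F w in at w0. cmod (G w) < 1"
        using G0 by (intro order_tendstoD[OF tendsto_norm]) (auto simp: isCont_def)
      moreover have "\<forall>\<^sub>F w in at w0. w \<noteq> 0" by (rule eventually_neq_at_within)
      moreover have "\<forall>\<^sub>F w in at w0. cmod w < d"
        using w0(2) by (intro order_tendstoD[OF tendsto_norm[OF tendsto_ident_at]])
      moreover have "\<forall>\<^sub>F w in at w0. w \<in> ball w0 r - {w0}"
        using eventually_at_ball'[OF r(1), of w0 UNIV] by (rule eventually_mono) auto
      ultimately have "\<forall>\<^sub>F w in at w0. False"
      proof eventually_elim
        case (elim w)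
        have "cmod (inverse (G w)) > 1" using elim(1) r(2)[OF elim(4)] by (simp add: norm_inverse one_less_inverse)
        with d(2)[OF elim(2,3)] show False by simp
      qed
      thus False by simp
    qed
    define E where "E = (\<lambda>w. if w = 0 then 0 else (inverse \<circ> G) w)"
    have E: "E holomorphic_on ball 0 d" unfolding E_def
    proof (rule removable_singularity[OF _ open_ball lim])
      show "inverse \<circ> G holomorphic_on ball 0 d - {0}" unfolding o_def
        by (intro holomorphic_intros holomorphic_on_subset[OF G]) (auto simp: Gnz)
    qed
    have EG: "E w = inverse (G w)" if "w \<noteq> 0" for w using that by (simp add: E_def)
    have E0: "E 0 = 0" by (simp add: E_def)
    have Enc: "\<not> E constant_on ball 0 d"
    proof
      assume "E constant_on ball 0 d"
      hence "E (of_real (d/2)) = E 0" using d(1) by (auto simp: constant_on_def)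
      thus False using Gnz[of "of_real (d/2)"] d(1) by (simp add: E_def)
    qed
    have d0: "0 \<in> ball (0::complex) d" using d(1) by simp
    obtain e r n where n: "0 < n" and r: "0 < r" "ball 0 r \<subseteq> ball (0::complex) d"
      and e: "e holomorphic_on ball 0 r" "\<And>w. w \<in> ball 0 r \<Longrightarrow> E w = (w - 0) ^ n * e w"
        "\<And>w. w \<in> ball 0 r \<Longrightarrow> e w \<noteq> 0"
      by (rule holomorphic_factor_zero_nonconstant[OF E open_ball connected_ball d0 E0 Enc], rule that) assumption+
    have "continuous_on (ball 0 r) (\<lambda>w. w * (deriv e w / e w))"
      using holomorphic_on_imp_continuous_on[OF holomorphic_deriv[OF e(1) open_ball]]
        holomorphic_on_imp_continuous_on[OF e(1)] e(3)
      by (intro continuous_intros) auto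
    hence "isCont (\<lambda>w. w * (deriv e w / e w)) 0" using r(1) by (simp add: continuous_on_eq_continuous_at)
    hence "((\<lambda>w. w * (deriv e w / e w)) \<longlongrightarrow> 0) (at 0)" by (simp add: isCont_def)
    hence "\<forall>\<^sub>F w in at 0. cmod (w * (deriv e w / e w)) < 1"
      by (intro order_tendstoD[OF tendsto_norm]) auto
    then obtain d' where d': "d' > 0" "\<And>w. \<lbrakk>w \<noteq> 0; cmod w < d'\<rbrakk> \<Longrightarrow> cmod (w * (deriv e w / e w)) < 1"
      by (auto simp: eventually_at)
    define s where "s = min r d'"
    have s: "s > 0" using r d' by (simp add: s_def)
    have "open (E ` ball 0 s)"
      by (rule open_mapping_thm[OF E open_ball connected_ball open_ball _ Enc]) (use r in \<open>auto simp: s_def\<close>)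
    moreover have "0 \<in> E ` ball 0 s" using s E0 by (intro image_eqI[of _ _ 0]) auto
    ultimately obtain \<rho> where \<rho>: "\<rho> > 0" "ball 0 \<rho> \<subseteq> E ` ball 0 s" using openE by blast
    \<comment> \<open>Any \<open>t > 1\<close> with \<open>1 / t < \<rho>\<close> does.\<close>
    define t where "t = 2 + 1 / \<rho>"
    have t1: "t > 1" using \<rho>(1) by (simp add: t_def add_pos_nonneg)
    have "1 / t < \<rho>" using \<rho>(1) t1 by (simp add: t_def field_simps)
    hence "complex_of_real (1 / t) \<in> ball 0 \<rho>" using t1 by (simp add: norm_divide)
    then obtain w where w: "w \<in> ball 0 s" "E w = of_real (1 / t)" using \<rho>(2) by (metis (no_types, lifting) image_iff subsetD)
    have w0: "w \<noteq> 0" using w(2) E0 t1 by auto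
    have ws: "w \<in> ball 0 r" "cmod w < d'" "w \<in> ball 0 d" using w(1) r(2) by (auto simp: s_def)
    have Gw: "G w = of_real t" using w(2) EG[OF w0] t1 by (simp add: inverse_eq_divide[symmetric])
    have sol: "f (inverse w) = of_real t * inverse w" using Gf[OF w0] Gw by simp
    have ed: "(e has_field_derivative deriv e w) (at w)"
      using e(1) ws by (intro holomorphic_derivI[of _ "ball 0 r"]) auto
    \<comment> \<open>Differentiating \<open>E w * G w = 1\<close> at this point gives \<open>f' (1 / w) / t = 1 + w E' w / E w\<close>.\<close>
    define E' where "E' = of_nat n * w ^ (n - 1) * e w + w ^ n * deriv e w"
    have "((\<lambda>w. w ^ n * e w) has_field_derivative E') (at w)"
      unfolding E'_def by (auto intro!: derivative_eq_intros ed)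
    hence Ed: "(E has_field_derivative E') (at w)"
      by (rule has_field_derivative_transform_within_open[OF _ open_ball ws(1)]) (simp add: e(2))
    have "(G has_field_derivative (f (inverse w) - deriv f (inverse w) * inverse w)) (at w)"
      unfolding G_def using w0
      by (auto intro!: derivative_eq_intros DERIV_chain2[OF fd] simp: field_simps power2_eq_square)
    from DERIV_mult[OF Ed this]
    have "((\<lambda>w. E w * G w) has_field_derivative
             (E' * G w + (f (inverse w) - deriv f (inverse w) * inverse w) * E w)) (at w)" .
    moreover have "((\<lambda>w. E w * G w) has_field_derivative 0) (at w)"
    proof (rule has_field_derivative_transform_within_open[where f = "\<lambda>_. 1" and S = "ball 0 d - {0}"])
      show "1 = E x * G x" if "x \<in> ball 0 d - {0}" for x using that Gnz[of x] EG[of x] by auto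
    qed (use ws w0 in auto)
    ultimately have "E' * G w + (f (inverse w) - deriv f (inverse w) * inverse w) * E w = 0"
      by (rule DERIV_unique)
    hence "deriv f (inverse w) = of_real t * (1 + w * (E' / E w))"
      using w0 t1 Gw[unfolded G_def] by (simp add: Gw w(2) field_simps)
    moreover have "w * (E' / E w) = of_nat n + w * (deriv e w / e w)"
    proof -
      define P where "P = w ^ (n - 1)"
      have "w ^ n = w * P" using n by (cases n) (auto simp: P_def)
      hence "E w = w * P * e w" "E' = of_nat n * P * e w + w * P * deriv e w"
        using e(2)[OF ws(1)] by (simp_all add: E'_def P_def)
      moreover have "P \<noteq> 0" using w0 by (simp add: P_def)
      ultimately show ?thesis using w0 e(3)[OF ws(1)] by (simp add: field_simps)
    qed
    moreover have "cmod (deriv f (inverse w)) \<le> t" by (rule bd[OF t1 sol])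
    ultimately have "t * cmod (1 + of_nat n + w * (deriv e w / e w)) \<le> t * 1"
      using t1 by (simp add: norm_mult add.assoc)
    hence "cmod (1 + of_nat n + w * (deriv e w / e w)) \<le> 1" using t1 by simp
    moreover have "cmod (1 + of_nat n) \<le> cmod (1 + of_nat n + w * (deriv e w / e w)) + cmod (w * (deriv e w / e w))"
      using norm_triangle_ineq4[of "1 + of_nat n + w * (deriv e w / e w)" "w * (deriv e w / e w)"] by simp
    moreover have "cmod (1 + of_nat n) = 1 + real n" by (metis norm_of_nat of_nat_Suc)
    ultimately show False using d'(2)[OF w0 ws(2)] n by linarith
  qed
  have no_limit_inverse: "\<not> ((inverse \<circ> G) \<longlongrightarrow> l) (at 0)" for l
  proof
    assume lim: "((inverse \<circ> G) \<longlongrightarrow> l) (at 0)"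
    with no_pole have "l \<noteq> 0" by auto
    from tendsto_inverse[OF lim this] have "(G \<longlongrightarrow> inverse l) (at 0)" by (simp add: o_def)
    with no_finite_limit show False by blast
  qed
  obtain a where a: "\<And>w. w \<noteq> a \<Longrightarrow> infinite {x. x \<in> UNIV - {0} \<and> G x = w}"
    using great_Picard_infinite[OF open_UNIV UNIV_I G no_finite_limit no_limit_inverse] by metis
  obtain t :: real where t: "t > 1" "of_real t \<noteq> a"
  proof (cases "a = of_real 2")
    case True
    thus thesis by (intro that[of 3]) auto
  next
    case False
    thus thesis by (intro that[of 2]) auto
  qed
  define X where "X = {x. x \<in> UNIV - {0} \<and> G x = of_real t}"
  have "infinite X" using a[OF t(2)] by (simp add: X_def)
  then obtain x where x: "x \<in> X" by (metis ex_in_conv finite.emptyI)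
  have "infinite (X - {x})" using \<open>infinite X\<close> by simp
  then obtain y where y: "y \<in> X" "y \<noteq> x" by (metis Diff_iff ex_in_conv finite.emptyI singletonI)
  have "f (inverse z) = of_real t * inverse z" "inverse z \<noteq> 0" if "z \<in> X" for z
    using that Gf[of z] by (auto simp: X_def)
  with unique_nonzero_ray_solution[OF hol nonlin bd t(1), of "inverse x" "inverse y"] x y show False by auto
qed

section \<open>Unitary matrices\<close>

definition hermitian_form :: "complex ^ 'n \<Rightarrow> complex ^ 'n \<Rightarrow> complex" where
  "hermitian_form x y = (\<Sum>i\<in>UNIV. x $ i * cnj (y $ i))"

lemma hermitian_form_linear:
  shows "hermitian_form (x + x') y = hermitian_form x y + hermitian_form x' y"
    and "hermitian_form (x - x') y = hermitian_form x y - hermitian_form x' y"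
    and "hermitian_form x (y - y') = hermitian_form x y - hermitian_form x y'"
    and "hermitian_form (c *s x) y = c * hermitian_form x y"
  by (simp_all add: hermitian_form_def algebra_simps sum.distrib sum_subtractf sum_distrib_left)

lemma cnj_hermitian_form: "cnj (hermitian_form x y) = hermitian_form y x"
  by (simp add: hermitian_form_def mult.commute)

lemma Re_hermitian_form: "Re (hermitian_form x y) = x \<bullet> y"
  by (simp add: hermitian_form_def inner_vec_def inner_complex_def)

lemma hermitian_form_self: "hermitian_form x x = of_real ((norm x)\<^sup>2)"
  by (simp add: complex_eq_iff Re_hermitian_form power2_norm_eq_inner)
     (simp add: hermitian_form_def)

lemma bounded_linear_hermitian_form: "bounded_linear (\<lambda>x. hermitian_form x y)"
  unfolding hermitian_form_def
  by (intro bounded_linear_sum bounded_linear_compose[OF bounded_linear_mult_left bounded_linear_vec_nth])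

lemma hermitian_form_conj_transpose:
  "hermitian_form (A *v x) y = hermitian_form x (conj_transpose A *v y)"
proof -
  have "hermitian_form (A *v x) y = (\<Sum>i\<in>UNIV. \<Sum>j\<in>UNIV. A $ i $ j * x $ j * cnj (y $ i))"
    by (simp add: hermitian_form_def matrix_vector_mult_def sum_distrib_right)
  also have "\<dots> = (\<Sum>j\<in>UNIV. \<Sum>i\<in>UNIV. A $ i $ j * x $ j * cnj (y $ i))" by (rule sum.swap)
  also have "\<dots> = hermitian_form x (conj_transpose A *v y)"
    by (simp add: hermitian_form_def matrix_vector_mult_def conj_transpose_def sum_distrib_left mult_ac)
  finally show ?thesis .
qed

lemma norm_vector_scalar_mult: "norm (c *s x) = cmod c * norm (x :: complex ^ 'n)"
  by (simp add: norm_vec_def norm_mult L2_set_right_distrib)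

definition unitary_matrix :: "complex ^ 'n ^ 'n \<Rightarrow> bool" where
  "unitary_matrix U \<longleftrightarrow> conj_transpose U ** U = mat 1"

lemma unitary_matrix_right: "unitary_matrix U \<Longrightarrow> U ** conj_transpose U = mat 1"
  unfolding unitary_matrix_def using matrix_left_right_inverse by blast

lemma SU_iff: "U \<in> SU \<longleftrightarrow> unitary_matrix U \<and> det U = 1"
  using unitary_matrix_right[of U] by (auto simp: SU_def unitary_matrix_def)

lemma unitary_matrix_one: "unitary_matrix (mat 1)"
proof -
  have "conj_transpose (mat 1 :: complex ^ 'n ^ 'n) = mat 1"
    by (auto simp: conj_transpose_def vec_eq_iff mat_def)
  thus ?thesis by (simp add: unitary_matrix_def)
qed

lemma conj_transpose_mult: "conj_transpose (A ** B) = conj_transpose B ** conj_transpose A"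
  by (simp add: conj_transpose_def matrix_matrix_mult_def vec_eq_iff mult.commute)

lemma det_conj_transpose: "det (conj_transpose A) = cnj (det A)"
proof -
  have "det (\<chi> i j. cnj (A $ i $ j)) = cnj (det A)" by (simp add: det_def)
  moreover have "conj_transpose A = transpose (\<chi> i j. cnj (A $ i $ j))"
    by (simp add: conj_transpose_def transpose_def vec_eq_iff)
  ultimately show ?thesis by (simp add: det_transpose)
qed

lemma unitary_matrix_mult: "unitary_matrix A \<Longrightarrow> unitary_matrix B \<Longrightarrow> unitary_matrix (A ** B)"
  unfolding unitary_matrix_def conj_transpose_mult
  by (metis matrix_mul_assoc matrix_mul_lid)

lemma norm_unitary_matrix:
  assumes "unitary_matrix U"
  shows "norm (U *v x) = norm x"
proof -
  have "hermitian_form (U *v x) (U *v x) = hermitian_form x x"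
    using assms by (simp add: hermitian_form_conj_transpose matrix_vector_mul_assoc unitary_matrix_def)
  hence "(norm (U *v x))\<^sup>2 = (norm x)\<^sup>2" by (simp only: hermitian_form_self of_real_eq_iff)
  thus ?thesis by simp
qed

text \<open>A complex Householder reflection: with \<open>w = x - y\<close>, the map \<open>v \<mapsto> v - c \<langle>v, w\<rangle> w\<close> sends \<open>x\<close> to \<open>y\<close> if
\<open>c = 1 / \<langle>x, w\<rangle>\<close>, and it is unitary if \<open>c + cnj c = \<bar>c\<bar>\<^sup>2 \<bar>w\<bar>\<^sup>2\<close>. The two requirements agree, since equal
norms of \<open>x\<close> and \<open>y\<close> give \<open>2 Re \<langle>x, w\<rangle> = \<bar>w\<bar>\<^sup>2\<close>.\<close>

lemma exists_unitary_matrix_mapping: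
  fixes x y :: "complex ^ 'n"
  assumes "norm x = norm y"
  obtains U where "unitary_matrix U" "U *v x = y"
proof (cases "x = y")
  case True
  thus ?thesis using that[OF unitary_matrix_one] by simp
next
  case False
  define w where "w = x - y"
  define b where "b = hermitian_form x w"
  define c where "c = 1 / b"
  define U :: "complex ^ 'n ^ 'n" where "U = (\<chi> i j. (if i = j then 1 else 0) - c * (w $ i * cnj (w $ j)))"
  have nw: "(norm w)\<^sup>2 > 0" using False by (simp add: w_def)
  have bw: "b + cnj b = of_real ((norm w)\<^sup>2)"
  proof -
    have "hermitian_form y y = hermitian_form x x" by (simp add: hermitian_form_self assms)
    thus ?thesis unfolding hermitian_form_self[symmetric] b_def cnj_hermitian_form
      by (simp add: w_def hermitian_form_linear)
  qed
  have b0: "b \<noteq> 0" using bw nw by auto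
  have cc: "c + cnj c = c * cnj c * of_real ((norm w)\<^sup>2)"
    unfolding bw[symmetric] c_def using b0 by (simp add: field_simps)
  have Uv: "U *v v = v - (c * hermitian_form v w) *s w" for v
    by (simp add: U_def vec_eq_iff matrix_vector_mult_def hermitian_form_def algebra_simps sum_subtractf
        sum_distrib_left if_distrib[of "\<lambda>c. _ * c"] cong: if_cong)
  have ct: "conj_transpose U *v v = v - (cnj c * hermitian_form v w) *s w" for v
    by (simp add: U_def conj_transpose_def vec_eq_iff matrix_vector_mult_def hermitian_form_def algebra_simps
        sum_subtractf sum_distrib_left if_distrib[of "\<lambda>c. _ * c"] if_distrib[of cnj] eq_commute cong: if_cong)
  have "(conj_transpose U ** U) *v v = mat 1 *v v" for v
  proof -
    define h where "h = hermitian_form v w"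
    have "(conj_transpose U ** U) *v v
        = (v - (c * h) *s w) - (cnj c * (h - c * h * of_real ((norm w)\<^sup>2))) *s w"
      by (simp add: matrix_vector_mul_assoc[symmetric] Uv ct hermitian_form_linear hermitian_form_self h_def)
    also have "\<dots> = v - (h * (c + cnj c - c * cnj c * of_real ((norm w)\<^sup>2))) *s w"
      by (simp add: vec_eq_iff algebra_simps)
    also have "\<dots> = v" using cc by simp
    finally show ?thesis by simp
  qed
  hence "unitary_matrix U" unfolding unitary_matrix_def matrix_eq by blast
  moreover have "U *v x = y" using b0 by (simp add: Uv b_def[symmetric] c_def) (simp add: w_def)
  ultimately show ?thesis by (rule that)
qed

text \<open>Map \<open>x\<close> to \<open>y\<close> by unitary matrices through a multiple \<open>e\<close> of a basis vector. The determinant is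
corrected in between by a diagonal matrix that fixes \<open>e\<close>; this takes a second coordinate, hence the
bound on the dimension.\<close>

lemma SU_transitive_on_spheres:
  fixes x y :: "complex ^ 'n"
  assumes card: "CARD('n) \<ge> 2" and xy: "norm x = norm y" and x0: "x \<noteq> 0"
  obtains U where "U \<in> SU" "U *v x = y"
proof -
  obtain i j :: 'n where ij: "i \<noteq> j"
    using card card_2_iff' by (metis (mono_tags, opaque_lifting) UNIV_I card_le_Suc0_iff_eq finite not_less_eq_eq numeral_2_eq_2)
  define e :: "complex ^ 'n" where "e = axis i (of_real (norm x))"
  have ne: "norm e = norm x"
    by (simp add: e_def norm_vec_def axis_def L2_set_def if_distrib[of norm] if_distrib[of "\<lambda>x. x\<^sup>2"] sum_nonneg
        cong: if_cong)
  obtain P where P: "unitary_matrix P" "P *v x = e" using exists_unitary_matrix_mapping ne by metis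
  obtain Q where Q: "unitary_matrix Q" "Q *v e = y" using exists_unitary_matrix_mapping ne xy by metis
  define \<delta> where "\<delta> = cnj (det (Q ** P))"
  have dd: "\<delta> * det (Q ** P) = 1"
  proof -
    have "det (conj_transpose (Q ** P) ** (Q ** P)) = 1"
      using unitary_matrix_mult[OF Q(1) P(1)] by (simp add: unitary_matrix_def)
    thus ?thesis by (simp only: det_mul det_conj_transpose \<delta>_def)
  qed
  hence d1: "cnj \<delta> * \<delta> = 1" by (simp add: \<delta>_def mult.commute)
  define D :: "complex ^ 'n ^ 'n" where "D = (\<chi> k l. if k = l then (if k = j then \<delta> else 1) else 0)"
  have "unitary_matrix D"
    unfolding unitary_matrix_def vec_eq_iff
  proof (intro allI)
    fix k l
    have "(conj_transpose D ** D) $ k $ l = (\<Sum>m\<in>UNIV. cnj (D $ m $ k) * D $ m $ l)"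
      by (simp add: matrix_matrix_mult_def conj_transpose_def)
    also have "\<dots> = (\<Sum>m\<in>UNIV. if m = k then cnj (D $ k $ k) * D $ k $ l else 0)"
      by (rule sum.cong) (auto simp: D_def)
    finally have "(conj_transpose D ** D) $ k $ l = cnj (D $ k $ k) * D $ k $ l" by simp
    thus "(conj_transpose D ** D) $ k $ l = mat 1 $ k $ l" using d1 by (simp add: mat_def D_def)
  qed
  moreover have "det D = \<delta>"
  proof -
    have "det D = (\<Prod>k\<in>UNIV. D $ k $ k)" by (rule det_diagonal) (simp add: D_def)
    also have "\<dots> = \<delta>" by (simp add: D_def)
    finally show ?thesis .
  qed
  moreover have "D *v e = e"
    unfolding vec_eq_iff matrix_vector_mult_def e_def axis_def using ij
    by (auto simp: D_def if_distrib[of "\<lambda>c. c * _"] cong: if_cong)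
  ultimately have "Q ** D ** P \<in> SU" "(Q ** D ** P) *v x = y"
    using P Q dd by (simp_all add: SU_iff unitary_matrix_mult det_mul mult_ac matrix_vector_mul_assoc[symmetric])
  thus ?thesis by (rule that)
qed

section \<open>Order of vanishing and powers of the maximal ideal\<close>

definition vanishes_to_order :: "nat \<Rightarrow> ('a::real_normed_vector \<Rightarrow> complex) \<Rightarrow> 'a \<Rightarrow> bool" where
  "vanishes_to_order n h p \<longleftrightarrow> (\<exists>C. \<forall>\<^sub>F z in nhds p. cmod (h z) \<le> C * norm (z - p) ^ n)"

lemma has_derivative_imp_eventually_Lipschitz:
  fixes f :: "'a::real_normed_vector \<Rightarrow> 'b::real_normed_vector"
  assumes "(f has_derivative D) (at p)"
  obtains C where "C \<ge> 0" "\<forall>\<^sub>F z in nhds p. norm (f z - f p) \<le> C * norm (z - p)"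
proof -
  obtain K where K: "K > 0" "\<And>v. norm (D v) \<le> norm v * K"
    using bounded_linear.pos_bounded[OF has_derivative_bounded_linear[OF assms]] by blast
  obtain d where d: "d > 0" "\<And>z. norm (z - p) < d \<Longrightarrow> norm (f z - f p - D (z - p)) \<le> 1 * norm (z - p)"
    using assms unfolding has_derivative_at_alt by (metis zero_less_one)
  have "norm (f z - f p) \<le> (K + 1) * norm (z - p)" if "norm (z - p) < d" for z
    using d(2)[OF that] K(2)[of "z - p"] norm_triangle_ineq[of "f z - f p - D (z - p)" "D (z - p)"]
    by (simp add: algebra_simps)
  hence "\<forall>\<^sub>F z in nhds p. norm (f z - f p) \<le> (K + 1) * norm (z - p)"
    using d(1) by (auto simp: eventually_nhds_metric dist_norm)
  with K(1) show ?thesis by (intro that[of "K + 1"]) auto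
qed

lemma germ_max_pow_0: "germ_max_pow p 0 = carrier (germ_ring p)"
  and germ_max_pow_Suc:
    "germ_max_pow p (Suc n) = ideal_prod (germ_ring p) (germ_max_pow p n) (germ_max p)"
  by (simp_all add: germ_max_pow_def nat_pow_def ideals_set_def)

lemma vanishes_to_order_mult:
  assumes "vanishes_to_order m g p" "vanishes_to_order n h p"
  shows "vanishes_to_order (m + n) (\<lambda>z. g z * h z) p"
proof -
  obtain C D where CD: "\<forall>\<^sub>F z in nhds p. cmod (g z) \<le> C * norm (z - p) ^ m"
    "\<forall>\<^sub>F z in nhds p. cmod (h z) \<le> D * norm (z - p) ^ n"
    using assms unfolding vanishes_to_order_def by blast
  hence "\<forall>\<^sub>F z in nhds p. cmod (g z * h z) \<le> (C * D) * norm (z - p) ^ (m + n)"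
  proof eventually_elim
    case (elim z)
    have "cmod (g z) * cmod (h z) \<le> (C * norm (z - p) ^ m) * (D * norm (z - p) ^ n)"
      using elim by (intro mult_mono) (auto intro: order_trans[OF norm_ge_zero])
    thus ?case by (simp add: norm_mult power_add mult_ac)
  qed
  thus ?thesis unfolding vanishes_to_order_def by blast
qed

lemma vanishes_to_order_add:
  assumes "vanishes_to_order n g p" "vanishes_to_order n h p"
  shows "vanishes_to_order n (\<lambda>z. g z + h z) p"
proof -
  obtain C D where "\<forall>\<^sub>F z in nhds p. cmod (g z) \<le> C * norm (z - p) ^ n"
    "\<forall>\<^sub>F z in nhds p. cmod (h z) \<le> D * norm (z - p) ^ n"
    using assms unfolding vanishes_to_order_def by blast
  hence "\<forall>\<^sub>F z in nhds p. cmod (g z + h z) \<le> (C + D) * norm (z - p) ^ n"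
    by eventually_elim (rule order_trans[OF norm_triangle_ineq], simp add: algebra_simps)
  thus ?thesis unfolding vanishes_to_order_def by blast
qed

lemma vanishes_to_order_cong:
  assumes "\<forall>\<^sub>F z in nhds p. g z = h z" "vanishes_to_order n g p"
  shows "vanishes_to_order n h p"
proof -
  obtain C where "\<forall>\<^sub>F z in nhds p. cmod (g z) \<le> C * norm (z - p) ^ n"
    using assms(2) unfolding vanishes_to_order_def by blast
  with assms(1) have "\<forall>\<^sub>F z in nhds p. cmod (h z) \<le> C * norm (z - p) ^ n"
    by eventually_elim simp
  thus ?thesis unfolding vanishes_to_order_def by blast
qed

lemma holo_near_vanishing:
  assumes "holo_near p h" "h p = 0"
  shows "vanishes_to_order 1 h p"
proof -
  obtain D where "(h has_derivative D) (at p)"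
    using assms(1) unfolding holo_near_def holo_on_def by blast
  from has_derivative_imp_eventually_Lipschitz[OF this] show ?thesis
    using assms(2) by (auto simp: vanishes_to_order_def)
qed

lemma holo_near_continuous:
  assumes "holo_near p h"
  shows "isCont h p"
proof -
  obtain D where "(h has_derivative D) (at p)"
    using assms(1) unfolding holo_near_def holo_on_def by blast
  thus ?thesis by (rule has_derivative_continuous)
qed

text \<open>A power of the maximal ideal is bounded from above by a growth condition. Together with the powers of
single germs as its elements, this is all that the comparison of leading terms takes.\<close>

lemma germ_max_pow_vanishes:
  assumes "x \<in> germ_max_pow p n"
  shows "\<exists>h. x = germ p h \<and> vanishes_to_order n h p"
  using assms
proof (induction n arbitrary: x)
  case 0
  then obtain h where h: "x = germ p h" "holo_near p h" by (auto simp: germ_max_pow_0 germ_carrier)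
  have "(\<lambda>z. cmod (h z)) \<midarrow>p\<rightarrow> cmod (h p)"
    using holo_near_continuous[OF h(2)] by (intro tendsto_norm) (simp add: isCont_def)
  hence "\<forall>\<^sub>F z in at p. cmod (h z) < cmod (h p) + 1" by (rule order_tendstoD) simp
  hence "\<forall>\<^sub>F z in nhds p. cmod (h z) \<le> cmod (h p) + 1"
    by (auto simp: eventually_at_filter elim!: eventually_mono)
  hence "vanishes_to_order 0 h p" by (auto simp: vanishes_to_order_def)
  with h(1) show ?case by blast
next
  case (Suc n)
  from Suc.prems have "x \<in> ideal_prod (germ_ring p) (germ_max_pow p n) (germ_max p)"
    by (simp add: germ_max_pow_Suc)
  thus ?case
  proof induction
    case (prod i j)
    obtain g where g: "i = germ p g" "vanishes_to_order n g p" using Suc.IH[OF prod(1)] by blast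
    obtain h where h: "j = germ p h" "holo_near p h" "h p = 0" using prod(2) by (auto simp: germ_max_def)
    have "vanishes_to_order (Suc n) (\<lambda>z. g z * h z) p"
      using vanishes_to_order_mult[OF g(2) holo_near_vanishing[OF h(2,3)]] by simp
    thus ?case using g(1) h(1) germ_mult by blast
  next
    case (sum s1 s2)
    thus ?case using vanishes_to_order_add germ_add by blast
  qed
qed

lemma power_in_germ_max_pow:
  assumes "holo_near p l" "l p = 0"
  shows "germ p (\<lambda>z. l z ^ n) \<in> germ_max_pow p n"
proof (induction n)
  case 0
  show ?case by (auto simp: germ_max_pow_0 germ_carrier holo_near_const)
next
  case (Suc n)
  have "germ p l \<in> germ_max p" using assms by (auto simp: germ_max_def)
  from ideal_prod.prod[OF Suc this, of "germ_ring p"] show ?case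
    by (simp add: germ_max_pow_Suc germ_mult mult.commute)
qed

text \<open>The surjectivity of \<open>V\<^bsub>p,n\<^esub>\<close> onto the \<open>n\<close>-th graded piece is used for the class of an \<open>n\<close>-th power: \<open>V\<close>
contains a function with the same leading term.\<close>

lemma graded_piece_of_full_imp_leading_term:
  assumes full: "graded_piece p n = graded_piece_of V p n" and l: "holo_near p l" "l p = 0"
  obtains h where "h \<in> V" "vanishes_to_order (Suc n) (\<lambda>z. h z - l z ^ n) p"
proof -
  have "germ_max_pow p (Suc n) +>\<^bsub>germ_ring p\<^esub> germ p (\<lambda>z. l z ^ n) \<in> graded_piece_of V p n"
    unfolding full[symmetric] graded_piece_def using power_in_germ_max_pow[OF l] by blast
  then obtain h where h: "h \<in> V" "germ_max_pow p (Suc n) +>\<^bsub>germ_ring p\<^esub> germ p (\<lambda>z. l z ^ n)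
       = germ_max_pow p (Suc n) +>\<^bsub>germ_ring p\<^esub> germ p h"
    unfolding graded_piece_of_def vanishing_subspace_def by auto
  have "germ p (\<lambda>z. 0) \<in> germ_max_pow p (Suc n)"
    using power_in_germ_max_pow[OF holo_near_const[of p 0], of "Suc n"] by simp
  hence "germ p (\<lambda>z. 0) \<oplus>\<^bsub>germ_ring p\<^esub> germ p h \<in> germ_max_pow p (Suc n) +>\<^bsub>germ_ring p\<^esub> germ p h"
    unfolding a_r_coset_def' by blast
  hence "germ p h \<in> germ_max_pow p (Suc n) +>\<^bsub>germ_ring p\<^esub> germ p (\<lambda>z. l z ^ n)"
    unfolding h(2) by (simp add: germ_add)
  then obtain x where x: "x \<in> germ_max_pow p (Suc n)" "germ p h = x \<oplus>\<^bsub>germ_ring p\<^esub> germ p (\<lambda>z. l z ^ n)"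
    unfolding a_r_coset_def' by blast
  obtain g where g: "x = germ p g" "vanishes_to_order (Suc n) g p"
    using germ_max_pow_vanishes[OF x(1)] by blast
  have "\<forall>\<^sub>F z in nhds p. h z = g z + l z ^ n" using x(2) by (simp add: g(1) germ_add germ_eq_iff)
  hence "\<forall>\<^sub>F z in nhds p. g z = h z - l z ^ n" by eventually_elim simp
  from vanishes_to_order_cong[OF this g(2)] h(1) show ?thesis by (intro that)
qed

section \<open>Eigenvalues at a fixed point\<close>

text \<open>The set \<open>W\<close> in the proof asks for a bound \<open>c < 1\<close> on the whole of \<open>K\<close>, instead of pointwise values
below \<open>1\<close>, so that its openness is immediate.\<close>

lemma continuously_included_bound:
  assumes sub: "function_subspace V" and qn: "quasi_norm V N" and ci: "continuously_included V N"
    and K: "compact K"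
  obtains C where "C \<ge> 0" "\<And>h z. \<lbrakk>h \<in> V; z \<in> K\<rbrakk> \<Longrightarrow> cmod (h z) \<le> C * N h"
proof -
  define W where "W = {g \<in> entire. \<exists>c<1. \<forall>z\<in>K. cmod (g z) \<le> c}"
  have W: "openin entire_topology W"
    unfolding openin_entire_topology
  proof (intro conjI ballI)
    show "W \<subseteq> entire" by (auto simp: W_def)
    fix h assume "h \<in> W"
    then obtain c where c: "h \<in> entire" "c < 1" "\<And>z. z \<in> K \<Longrightarrow> cmod (h z) \<le> c" by (auto simp: W_def)
    have "g \<in> W" if g: "g \<in> entire" "\<forall>z\<in>K. cmod (g z - h z) < (1 - c) / 2" for g
    proof -
      have "cmod (g z) \<le> (1 + c) / 2" if "z \<in> K" for z
        using c(3)[OF that] g(2) that norm_triangle_ineq[of "g z - h z" "h z"] by (fastforce simp: field_simps)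
      thus ?thesis using g(1) c(2) by (auto simp: W_def intro!: exI[of _ "(1 + c) / 2"])
    qed
    thus "\<exists>K e. compact K \<and> e > 0 \<and> (\<forall>g\<in>entire. (\<forall>z\<in>K. cmod (g z - h z) < e) \<longrightarrow> g \<in> W)"
      using K c(2) by (intro exI[of _ K] exI[of _ "(1 - c) / 2"]) auto
  qed
  have V: "topspace (quasi_norm_topology V N) = V"
  proof
    show "topspace (quasi_norm_topology V N) \<subseteq> V"
      using openin_topspace[of "quasi_norm_topology V N"] unfolding openin_quasi_norm_topology by blast
    have "openin (quasi_norm_topology V N) V" unfolding openin_quasi_norm_topology by (auto intro: exI[of _ 1])
    thus "V \<subseteq> topspace (quasi_norm_topology V N)" by (rule openin_subset)
  qed
  have "continuous_map (quasi_norm_topology V N) entire_topology (\<lambda>h. h)"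
    using ci by (simp add: continuously_included_def)
  from openin_continuous_map_preimage[OF this W]
  have "openin (quasi_norm_topology V N) {h \<in> V. h \<in> W}" by (simp only: V)
  hence nbhd: "\<forall>h\<in>{h \<in> V. h \<in> W}. \<exists>e>0. \<forall>g\<in>V. N (\<lambda>x. g x - h x) < e \<longrightarrow> g \<in> {h \<in> V. h \<in> W}"
    unfolding openin_quasi_norm_topology by (rule conjunct2)
  have "(\<lambda>x. 0) \<in> {h \<in> V. h \<in> W}"
    using sub by (auto simp: function_subspace_def W_def entire_def holo_on_const intro!: exI[of _ 0])
  from bspec[OF nbhd this] obtain e where e: "e > 0" "\<And>g. \<lbrakk>g \<in> V; N (\<lambda>x. g x - 0) < e\<rbrakk> \<Longrightarrow> g \<in> W"
    by auto
  show ?thesis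
  proof (rule that[of "2 / e"])
    show "0 \<le> 2 / e" using e(1) by simp
    fix h z assume h: "h \<in> V" "z \<in> K"
    have N0: "N h \<ge> 0" using qn h(1) by (auto simp: quasi_norm_def)
    show "cmod (h z) \<le> 2 / e * N h"
    proof (cases "N h = 0")
      case True
      hence "h = (\<lambda>x. 0)" using qn h(1) by (auto simp: quasi_norm_def)
      thus ?thesis using True by simp
    next
      case False
      with N0 have N1: "N h > 0" by simp
      define a where "a = complex_of_real (e / (2 * N h))"
      have ca: "cmod a = e / (2 * N h)" using N1 e(1) by (simp add: a_def norm_divide norm_mult)
      have "N (\<lambda>x. a * h x) = cmod a * N h" using qn h(1) by (auto simp: quasi_norm_def)
      also have "\<dots> < e" using N1 e(1) by (simp add: ca)
      finally have "(\<lambda>x. a * h x) \<in> W" using e(2)[of "\<lambda>x. a * h x"] sub h(1) by (auto simp: function_subspace_def)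
      then obtain c where "c < 1" "\<forall>z\<in>K. cmod (a * h z) \<le> c" by (auto simp: W_def)
      hence "cmod (a * h z) < 1" using h(2) by fastforce
      hence "e / (2 * N h) * cmod (h z) < 1" by (simp add: norm_mult ca)
      thus ?thesis using N1 e(1) by (simp add: field_simps)
    qed
  qed
qed

lemma has_derivative_vector_scalar_line:
  "((\<lambda>\<zeta>::complex. p + \<zeta> *s v) has_derivative (\<lambda>\<zeta>. \<zeta> *s (v :: complex ^ 'n))) (at x)"
proof -
  have "linear (\<lambda>\<zeta>::complex. \<zeta> *s v)"
    by (rule linearI) (simp_all add: vec_eq_iff algebra_simps)
  hence "bounded_linear (\<lambda>\<zeta>::complex. \<zeta> *s v)" by (simp add: linear_conv_bounded_linear)
  from bounded_linear_imp_has_derivative[OF this] show ?thesis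
    by (auto intro!: derivative_eq_intros)
qed

lemma holomorphic_on_entire_along_line:
  assumes "h \<in> entire"
  shows "(\<lambda>\<zeta>. h (p + \<zeta> *s v)) holomorphic_on UNIV"
  unfolding holomorphic_on_open[OF open_UNIV]
proof
  fix x
  obtain D where D: "(h has_derivative D) (at (p + x *s v))" "\<And>c u. D (c *s u) = c * D u"
    using assms unfolding entire_def holo_on_def by blast
  have "((\<lambda>\<zeta>. h (p + \<zeta> *s v)) has_derivative (\<lambda>\<zeta>. D (\<zeta> *s v))) (at x)"
    using has_derivative_compose[OF has_derivative_vector_scalar_line D(1)] by simp
  hence "((\<lambda>\<zeta>. h (p + \<zeta> *s v)) has_field_derivative D v) (at x)"
    by (simp add: has_field_derivative_def D(2) mult.commute[of _ "D v"])
  thus "\<exists>f'. ((\<lambda>\<zeta>. h (p + \<zeta> *s v)) has_field_derivative f') (at x)" by blast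
qed

text \<open>The quotient \<open>\<phi> \<zeta> / \<zeta> ^ n\<close> extends holomorphically to \<open>0\<close> with value \<open>c\<close>, and on the unit circle it is
as large as \<open>\<phi>\<close>.\<close>

lemma norm_leading_coefficient_le:
  assumes hol: "\<phi> holomorphic_on UNIV" and lim: "((\<lambda>\<zeta>. \<phi> \<zeta> / \<zeta> ^ n) \<longlongrightarrow> c) (at 0)"
    and bd: "\<And>\<zeta>. cmod \<zeta> = 1 \<Longrightarrow> cmod (\<phi> \<zeta>) \<le> B"
  shows "cmod c \<le> B"
proof -
  define \<psi> where "\<psi> = (\<lambda>\<zeta>. if \<zeta> = 0 then c else \<phi> \<zeta> / \<zeta> ^ n)"
  have h: "\<psi> holomorphic_on UNIV" unfolding \<psi>_def
    by (rule removable_singularity[OF _ open_UNIV lim])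
       (auto intro!: holomorphic_intros holomorphic_on_subset[OF hol])
  have "cmod ((deriv ^^ 0) \<psi> 0) \<le> fact 0 * B / 1 ^ 0"
  proof (rule Cauchy_inequality)
    show "\<psi> holomorphic_on ball 0 1" "continuous_on (cball 0 1) \<psi>"
      using h by (auto intro: holomorphic_on_subset holomorphic_on_imp_continuous_on)
    fix x :: complex assume "cmod (0 - x) = 1"
    thus "cmod (\<psi> x) \<le> B" using bd[of x] by (auto simp: \<psi>_def norm_divide norm_power)
  qed simp
  thus ?thesis by (simp add: \<psi>_def)
qed

text \<open>This says that the homogeneous part of degree \<open>n\<close> of \<open>h\<close> at \<open>p\<close> is \<open>P\<close> and that the lower parts vanish.
It is tested on all curves through \<open>p\<close>, and not only on lines, so that composition with a map
fixing \<open>p\<close> reduces to the chain rule.\<close>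

definition leading_form ::
    "nat \<Rightarrow> (complex ^ 'n \<Rightarrow> complex) \<Rightarrow> complex ^ 'n \<Rightarrow> (complex ^ 'n \<Rightarrow> complex) \<Rightarrow> bool" where
  "leading_form n h p P \<longleftrightarrow> (\<forall>\<gamma> v. \<gamma> 0 = p \<longrightarrow> (\<gamma> has_derivative (\<lambda>\<zeta>. \<zeta> *s v)) (at 0) \<longrightarrow>
      ((\<lambda>\<zeta>. h (\<gamma> \<zeta>) / \<zeta> ^ n) \<longlongrightarrow> P v) (at 0))"

lemma leading_form_power:
  fixes l :: "complex ^ 'n \<Rightarrow> complex"
  assumes l: "bounded_linear l" "\<And>c v. l (c *s v) = c * l v"
    and van: "vanishes_to_order (Suc n) (\<lambda>z. h z - l (z - p) ^ n) p"
  shows "leading_form n h p (\<lambda>v. l v ^ n)"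
  unfolding leading_form_def
proof (intro allI impI)
  fix \<gamma> :: "complex \<Rightarrow> complex ^ 'n" and v assume \<gamma>: "\<gamma> 0 = p" "(\<gamma> has_derivative (\<lambda>\<zeta>. \<zeta> *s v)) (at 0)"
  have "((\<lambda>\<zeta>. l (\<gamma> \<zeta> - p)) has_derivative (\<lambda>\<zeta>. l (\<zeta> *s v - 0))) (at 0)"
    by (intro bounded_linear.has_derivative[OF l(1)] has_derivative_diff \<gamma>(2) has_derivative_const)
  hence "((\<lambda>\<zeta>. l (\<gamma> \<zeta> - p)) has_field_derivative l v) (at 0)"
    by (simp add: has_field_derivative_def l(2) mult.commute[of _ "l v"])
  hence l1: "((\<lambda>\<zeta>. l (\<gamma> \<zeta> - p) / \<zeta>) \<longlongrightarrow> l v) (at 0)"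
    using linear_0[OF bounded_linear.linear[OF l(1)]] by (simp add: DERIV_def \<gamma>(1))
  obtain K where K: "K \<ge> 0" "\<forall>\<^sub>F \<zeta> in nhds 0. norm (\<gamma> \<zeta> - \<gamma> 0) \<le> K * norm (\<zeta> - 0)"
    using has_derivative_imp_eventually_Lipschitz[OF \<gamma>(2)] by blast
  obtain C0 where C0: "\<forall>\<^sub>F z in nhds p. cmod (h z - l (z - p) ^ n) \<le> C0 * norm (z - p) ^ Suc n"
    using van unfolding vanishes_to_order_def by blast
  define C where "C = max C0 0"
  have C: "\<forall>\<^sub>F z in nhds p. cmod (h z - l (z - p) ^ n) \<le> C * norm (z - p) ^ Suc n" "C \<ge> 0"
    using C0 by (auto simp: C_def elim!: eventually_mono intro: order_trans[OF _ mult_right_mono])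
  have "filterlim \<gamma> (nhds p) (at 0)"
    using has_derivative_continuous[OF \<gamma>(2)] \<gamma>(1) by (simp add: isCont_def)
  from eventually_compose_filterlim[OF C(1) this]
  have "\<forall>\<^sub>F \<zeta> in at 0. cmod (h (\<gamma> \<zeta>) - l (\<gamma> \<zeta> - p) ^ n) \<le> C * norm (\<gamma> \<zeta> - p) ^ Suc n" .
  moreover have "\<forall>\<^sub>F \<zeta> in at 0. norm (\<gamma> \<zeta> - p) \<le> K * norm \<zeta>"
    using K(2) \<gamma>(1) by (simp add: eventually_at_filter eventually_mono)
  moreover have "\<forall>\<^sub>F \<zeta> in at 0. \<zeta> \<noteq> (0::complex)" by (simp add: eventually_at_filter)
  ultimately have ev: "\<forall>\<^sub>F \<zeta> in at 0. cmod ((h (\<gamma> \<zeta>) - l (\<gamma> \<zeta> - p) ^ n) / \<zeta> ^ n) \<le> C * K ^ Suc n * norm \<zeta>"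
  proof eventually_elim
    case (elim \<zeta>)
    have "cmod (h (\<gamma> \<zeta>) - l (\<gamma> \<zeta> - p) ^ n) \<le> C * norm (\<gamma> \<zeta> - p) ^ Suc n" by (rule elim(1))
    also have "\<dots> \<le> C * (K * norm \<zeta>) ^ Suc n" using elim(2) C(2) by (intro mult_left_mono power_mono) auto
    also have "\<dots> = C * K ^ Suc n * norm \<zeta> * norm \<zeta> ^ n" by (simp add: power_mult_distrib)
    finally show ?case using elim(3) by (simp add: norm_divide norm_power divide_le_eq)
  qed
  have "((\<lambda>\<zeta>::complex. C * K ^ Suc n * norm \<zeta>) \<longlongrightarrow> C * K ^ Suc n * norm (0::complex)) (at 0)"
    by (intro tendsto_mult tendsto_const tendsto_norm tendsto_ident_at)
  hence "((\<lambda>\<zeta>::complex. C * K ^ Suc n * norm \<zeta>) \<longlongrightarrow> 0) (at 0)" by simp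
  from Lim_null_comparison[OF ev this]
  have "((\<lambda>\<zeta>. (h (\<gamma> \<zeta>) - l (\<gamma> \<zeta> - p) ^ n) / \<zeta> ^ n) \<longlongrightarrow> 0) (at 0)" .
  from tendsto_add[OF this tendsto_power[OF l1, of n]]
  show "((\<lambda>\<zeta>. h (\<gamma> \<zeta>) / \<zeta> ^ n) \<longlongrightarrow> l v ^ n) (at 0)"
    by (simp add: diff_divide_distrib power_divide)
qed

lemma leading_form_wcomp:
  fixes g :: "complex ^ 'n \<Rightarrow> complex ^ 'n"
  assumes lf: "leading_form n h p P" and w: "isCont w p"
    and g: "g p = p" "(g has_derivative A) (at p)" "\<And>c v. A (c *s v) = c *s A v"
  shows "leading_form n (wcomp w g h) p (\<lambda>v. w p * P (A v))"
  unfolding leading_form_def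
proof (intro allI impI)
  fix \<gamma> :: "complex \<Rightarrow> complex ^ 'n" and v assume \<gamma>: "\<gamma> 0 = p" "(\<gamma> has_derivative (\<lambda>\<zeta>. \<zeta> *s v)) (at 0)"
  have "((\<lambda>\<zeta>. g (\<gamma> \<zeta>)) has_derivative (\<lambda>\<zeta>. \<zeta> *s A v)) (at 0)"
    using has_derivative_compose[OF \<gamma>(2), of g A] g \<gamma>(1) by simp
  hence "((\<lambda>\<zeta>. h (g (\<gamma> \<zeta>)) / \<zeta> ^ n) \<longlongrightarrow> P (A v)) (at 0)"
    using lf g(1) \<gamma>(1) unfolding leading_form_def by simp
  moreover have "((\<lambda>\<zeta>. w (\<gamma> \<zeta>)) \<longlongrightarrow> w p) (at 0)"
    using has_derivative_continuous[OF \<gamma>(2)] \<gamma>(1) w isCont_tendsto_compose unfolding isCont_def by metis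
  ultimately have "((\<lambda>\<zeta>. w (\<gamma> \<zeta>) * (h (g (\<gamma> \<zeta>)) / \<zeta> ^ n)) \<longlongrightarrow> w p * P (A v)) (at 0)"
    by (intro tendsto_mult)
  thus "((\<lambda>\<zeta>. wcomp w g h (\<gamma> \<zeta>) / \<zeta> ^ n) \<longlongrightarrow> w p * P (A v)) (at 0)"
    by (simp add: wcomp_def)
qed

lemma le_of_power_le_mult_power:
  fixes x c M :: real
  assumes "\<And>k. x ^ k \<le> M * c ^ k" "c > 0"
  shows "x \<le> c"
proof (rule ccontr)
  assume "\<not> x \<le> c"
  hence "x / c > 1" using assms(2) by simp
  then obtain k where "M < (x / c) ^ k" using real_arch_pow by blast
  with assms(1)[of k] assms(2) show False by (simp add: power_divide field_simps)
qed

text \<open>If \<open>l\<close> is an eigenvector of the transpose of \<open>A\<close> with eigenvalue \<open>\<mu>\<close>, the weighted composition operator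
multiplies the leading term \<open>l ^ n\<close> by \<open>w p * \<mu> ^ n\<close>. Its \<open>k\<close>-th power multiplies it by the
\<open>k\<close>-th power of that number, but has operator norm at most \<open>C ^ k\<close>; as the leading coefficient
along a line is bounded by the quasi-norm, \<open>\<bar>w p\<bar> \<bar>\<mu>\<bar> ^ n \<le> C\<close> follows. This holds for infinitely
many \<open>n\<close> with the same \<open>C\<close>, which forces \<open>\<bar>\<mu>\<bar> \<le> 1\<close>.\<close>

lemma cotangent_eigenvalue_le_1:
  fixes V :: "(complex ^ 'n \<Rightarrow> complex) set"
  assumes sub: "function_subspace V" and qn: "quasi_norm V N" and ci: "continuously_included V N"
    and inf: "infinite {n. graded_piece p n = graded_piece_of V p n}"
    and bdd: "wcomp_bounded V N w g" and w: "isCont w p" "w p \<noteq> 0"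
    and g: "g p = p" "(g has_derivative A) (at p)" "\<And>c v. A (c *s v) = c *s A v"
    and l: "bounded_linear l" "\<And>c v. l (c *s v) = c * l v" "l e \<noteq> 0"
    and eig: "\<And>v. l (A v) = \<mu> * l v"
  shows "cmod \<mu> \<le> 1"
proof -
  define T where "T = wcomp w g"
  obtain C0 where C0: "\<And>h. h \<in> V \<Longrightarrow> N (T h) \<le> C0 * N h" using bdd by (auto simp: wcomp_bounded_def T_def)
  define C where "C = max C0 1"
  have N0: "N h \<ge> 0" if "h \<in> V" for h using qn that by (auto simp: quasi_norm_def)
  have C: "N (T h) \<le> C * N h" if "h \<in> V" for h
    using C0[OF that] mult_right_mono[of C0 C "N h"] N0[OF that] by (simp add: C_def)
  have TV: "T h \<in> V" if "h \<in> V" for h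
    using bdd that by (auto simp: wcomp_bounded_def wcomp_dom_def T_def)
  have TkV: "(T ^^ k) h \<in> V" if "h \<in> V" for h k using that TV by (induction k) auto
  have Nk: "N ((T ^^ k) h) \<le> C ^ k * N h" if "h \<in> V" for h k
  proof (induction k)
    case (Suc k)
    have "N ((T ^^ Suc k) h) \<le> C * N ((T ^^ k) h)" using C[OF TkV[OF that]] by simp
    also have "\<dots> \<le> C * (C ^ k * N h)" using Suc by (intro mult_left_mono) (auto simp: C_def)
    finally show ?case by simp
  qed simp
  define v where "v = (1 / l e) *s e"
  have lv: "l v = 1" using l(2,3) by (simp add: v_def)
  define K where "K = (\<lambda>\<zeta>. p + \<zeta> *s v) ` sphere 0 1"
  have "continuous_on (sphere 0 1) (\<lambda>\<zeta>::complex. p + \<zeta> *s v)"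
    by (intro continuous_at_imp_continuous_on ballI)
       (rule has_derivative_continuous[OF has_derivative_vector_scalar_line])
  hence "compact K" unfolding K_def by (intro compact_continuous_image) auto
  from continuously_included_bound[OF sub qn ci this] obtain B
    where B: "B \<ge> 0" "\<And>h z. \<lbrakk>h \<in> V; z \<in> K\<rbrakk> \<Longrightarrow> cmod (h z) \<le> B * N h" by metis
  have main: "cmod (w p) * cmod \<mu> ^ n \<le> C" if n: "graded_piece p n = graded_piece_of V p n" for n
  proof -
    have l0: "l 0 = 0" using linear_0[OF bounded_linear.linear[OF l(1)]] .
    have "((\<lambda>z. l (z - p)) has_derivative l) (at z)" for z
      by (rule has_derivative_eq_rhs[OF bounded_linear.has_derivative[OF l(1) has_derivative_diff[OF has_derivative_ident has_derivative_const]]]) simp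
    hence "holo_on (\<lambda>z. l (z - p)) UNIV" unfolding holo_on_def using l(2) by blast
    hence "holo_near p (\<lambda>z. l (z - p))" unfolding holo_near_def by blast
    from graded_piece_of_full_imp_leading_term[OF n this] l0 obtain h
      where h: "h \<in> V" "vanishes_to_order (Suc n) (\<lambda>z. h z - l (z - p) ^ n) p" by auto
    have lf: "leading_form n ((T ^^ k) h) p (\<lambda>v. (w p * \<mu> ^ n) ^ k * l v ^ n)" for k
    proof (induction k)
      case 0
      show ?case using leading_form_power[OF l(1,2) h(2)] by simp
    next
      case (Suc k)
      have "leading_form n (wcomp w g ((T ^^ k) h)) p (\<lambda>v. w p * ((w p * \<mu> ^ n) ^ k * l (A v) ^ n))"
        by (rule leading_form_wcomp[OF Suc w(1) g])
      thus ?case by (simp add: T_def eig power_mult_distrib mult_ac)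
    qed
    have "(cmod (w p) * cmod \<mu> ^ n) ^ k \<le> (B * N h) * C ^ k" for k
    proof -
      have "cmod ((w p * \<mu> ^ n) ^ k * l v ^ n) \<le> B * N ((T ^^ k) h)"
      proof (rule norm_leading_coefficient_le)
        have "(T ^^ k) h \<in> entire" using TkV[OF h(1)] ci by (auto simp: continuously_included_def)
        thus "(\<lambda>\<zeta>. (T ^^ k) h (p + \<zeta> *s v)) holomorphic_on UNIV" by (rule holomorphic_on_entire_along_line)
        show "((\<lambda>\<zeta>. (T ^^ k) h (p + \<zeta> *s v) / \<zeta> ^ n) \<longlongrightarrow> (w p * \<mu> ^ n) ^ k * l v ^ n) (at 0)"
          using lf[of k, unfolded leading_form_def, rule_format, of "\<lambda>\<zeta>. p + \<zeta> *s v" v,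
              OF _ has_derivative_vector_scalar_line] by simp
        fix \<zeta> :: complex assume "cmod \<zeta> = 1"
        thus "cmod ((T ^^ k) h (p + \<zeta> *s v)) \<le> B * N ((T ^^ k) h)"
          by (intro B(2) TkV h(1)) (auto simp: K_def)
      qed
      also have "\<dots> \<le> B * (C ^ k * N h)" using Nk[OF h(1)] B(1) by (rule mult_left_mono)
      finally show ?thesis by (simp add: lv norm_power norm_mult mult_ac)
    qed
    thus ?thesis by (rule le_of_power_le_mult_power) (simp add: C_def)
  qed
  show ?thesis
  proof (rule ccontr)
    assume "\<not> cmod \<mu> \<le> 1"
    hence l1: "cmod \<mu> > 1" by simp
    then obtain m where m: "C / cmod (w p) < cmod \<mu> ^ m" using real_arch_pow by blast
    obtain n where n: "n > m" "graded_piece p n = graded_piece_of V p n"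
      using inf by (auto simp: infinite_nat_iff_unbounded)
    have "cmod \<mu> ^ m \<le> cmod \<mu> ^ n" using l1 n(1) by (intro power_increasing) auto
    hence "cmod (w p) * cmod \<mu> ^ m \<le> cmod (w p) * cmod \<mu> ^ n" by (rule mult_left_mono) simp
    with m main[OF n(2)] w(2) show False by (simp add: field_simps)
  qed
qed

section \<open>Growth in dimension at least two\<close>

lemma holo_map_has_derivative:
  fixes f :: "complex ^ 'n \<Rightarrow> complex ^ 'n"
  assumes "holo_map f"
  obtains D where "(f has_derivative D) (at p)" "\<And>c v. D (c *s v) = c *s D v"
proof -
  have "\<exists>E. ((\<lambda>z. f z $ i) has_derivative E) (at p) \<and> (\<forall>c v. E (c *s v) = c * E v)" for i
    using assms unfolding holo_map_def entire_def holo_on_def by blast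
  then obtain E where E: "\<And>i. ((\<lambda>z. f z $ i) has_derivative E i) (at p)" "\<And>i c v. E i (c *s v) = c * E i v"
    by metis
  have "(f has_derivative (\<lambda>v. \<chi> i. E i v)) (at p)"
    unfolding has_derivative_componentwise_within[of f]
  proof
    fix b :: "complex ^ 'n" assume "b \<in> Basis"
    then obtain i c where b: "b = axis i c" by (auto simp: Basis_vec_def)
    show "((\<lambda>z. f z \<bullet> b) has_derivative (\<lambda>v. (\<chi> i. E i v) \<bullet> b)) (at p)"
      using bounded_linear.has_derivative[OF bounded_linear_inner_left E(1)] by (simp add: b inner_axis)
  qed
  thus ?thesis by (rule that) (simp add: E(2) vec_eq_iff)
qed

text \<open>The real linear functional \<open>v \<mapsto> A v \<bullet> q - c (v \<bullet> q)\<close> is at most \<open>0\<close> on an open half space, hence also on the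
bounding hyperplane. There it vanishes by linearity, so it is a multiple of \<open>v \<bullet> q\<close>, and the
sign on the half space makes the factor nonnegative.\<close>

lemma real_left_eigenvector_of_inward_inequality:
  fixes A :: "complex ^ 'n \<Rightarrow> complex ^ 'n"
  assumes lin: "linear A" and q: "q \<noteq> 0"
    and ineq: "\<And>v. v \<bullet> q < 0 \<Longrightarrow> A v \<bullet> q \<le> c * (v \<bullet> q)"
  obtains k where "k \<ge> c" "\<And>v. A v \<bullet> q = k * (v \<bullet> q)"
proof -
  define B where "B = (\<lambda>v. A v \<bullet> q - c * (v \<bullet> q))"
  have B_add: "B (v + v') = B v + B v'" and B_scale: "B (r *\<^sub>R v) = r * B v" for v v' r
    by (simp_all add: B_def linear_add[OF lin] linear_cmul[OF lin] inner_add_left algebra_simps)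
  have qq: "q \<bullet> q > 0" using q by simp
  have Bq: "B q \<ge> 0"
    using ineq[of "- 1 *\<^sub>R q"] qq B_scale[of "- 1" q] by (simp add: B_def)
  have le: "B v \<le> 0" if "v \<bullet> q = 0" for v
  proof (rule ccontr)
    assume "\<not> B v \<le> 0"
    define b where "b = B q + 1"
    define s where "s = B v / (2 * b)"
    have b: "b > 0" using Bq by (simp add: b_def)
    hence s: "s > 0" using \<open>\<not> B v \<le> 0\<close> by (simp add: s_def)
    have "(v + (- s) *\<^sub>R q) \<bullet> q < 0" using that s qq by (simp add: inner_diff_left)
    from ineq[OF this] have "B (v + (- s) *\<^sub>R q) \<le> 0" by (simp add: B_def)
    hence "B v \<le> s * B q" using B_add[of v "(- s) *\<^sub>R q"] B_scale[of "- s" q] by linarith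
    also have "\<dots> \<le> s * b" using s by (intro mult_left_mono) (auto simp: b_def)
    also have "\<dots> = B v / 2" using b by (simp add: s_def)
    finally show False using \<open>\<not> B v \<le> 0\<close> by simp
  qed
  have B0: "B v = 0" if "v \<bullet> q = 0" for v
    using le[OF that] le[of "- 1 *\<^sub>R v"] that B_scale[of "- 1" v] by simp
  show ?thesis
  proof (rule that[of "c + B q / (q \<bullet> q)"])
    show "c \<le> c + B q / (q \<bullet> q)" using Bq qq by simp
    fix v
    define t where "t = (v \<bullet> q) / (q \<bullet> q)"
    have "(v + (- t) *\<^sub>R q) \<bullet> q = 0" using qq by (simp add: inner_diff_left t_def)
    from B0[OF this] have "B v = t * B q"
      using B_add[of v "(- t) *\<^sub>R q"] B_scale[of "- t" q] by linarith
    hence "A v \<bullet> q - c * (v \<bullet> q) = t * B q" by (simp add: B_def)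
    thus "A v \<bullet> q = (c + B q / (q \<bullet> q)) * (v \<bullet> q)" by (simp add: t_def algebra_simps)
  qed
qed

text \<open>A form of the lemma of Jack. Since \<open>g q \<bullet> q\<close> attains the bound \<open>\<bar>q\<bar>\<^sup>2 (\<bar>z\<bar> / \<bar>q\<bar>) powr m\<close> at \<open>z = q\<close> and
\<open>g z \<bullet> q\<close> stays below it on the inner side of the sphere, comparing derivatives in inward
directions gives \<open>A v \<bullet> q \<le> m (v \<bullet> q)\<close>. By the previous lemma \<open>q\<close> is a left eigenvector of
\<open>A\<close>, first in the real sense and then, by the complex linearity of \<open>A\<close>, in the hermitian one.\<close>

lemma left_eigenvector_at_boundary_fixed_point:
  fixes g :: "complex ^ 'n \<Rightarrow> complex ^ 'n"
  assumes fix_q: "g q = q" and q: "norm q > 1"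
    and A: "(g has_derivative A) (at q)" "\<And>c v. A (c *s v) = c *s A v"
    and bd: "\<And>z. \<lbrakk>1 \<le> norm z; norm z \<le> norm q\<rbrakk> \<Longrightarrow> norm (g z) \<le> norm q * (norm z / norm q) powr m"
  obtains k where "k \<ge> m" "\<And>v. hermitian_form (A v) q = of_real k * hermitian_form v q"
proof -
  have q0: "q \<noteq> 0" "q \<bullet> q > 0" using q by auto
  have lin: "linear A" using A(1) by (rule has_derivative_linear)
  have "A v \<bullet> q \<le> m * (v \<bullet> q)" if v: "v \<bullet> q < 0" for v
  proof (rule ccontr)
    assume contra: "\<not> A v \<bullet> q \<le> m * (v \<bullet> q)"
    \<comment> \<open>\<open>\<phi> s\<close> is \<open>(\<bar>q + s v\<bar> / \<bar>q\<bar>)\<^sup>2\<close>, written as a polynomial in \<open>s\<close>.\<close>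
    define \<phi> where "\<phi> = (\<lambda>s::real. 1 + 2 * s * (v \<bullet> q) / (q \<bullet> q) + s\<^sup>2 * (v \<bullet> v) / (q \<bullet> q))"
    have \<phi>: "(norm (q + s *\<^sub>R v) / norm q)\<^sup>2 = \<phi> s" for s
      unfolding power_divide power2_norm_eq_inner \<phi>_def
      using q0 by (simp add: inner_add_left inner_add_right inner_commute field_simps power2_eq_square)
    have \<phi>': "(\<phi> has_real_derivative 2 * (v \<bullet> q) / (q \<bullet> q)) (at 0)"
      unfolding \<phi>_def using q0 by (auto intro!: derivative_eq_intros)
    define \<rho> where "\<rho> = (\<lambda>s. (q \<bullet> q) * \<phi> s powr (m / 2) - g (q + s *\<^sub>R v) \<bullet> q)"
    have "((\<lambda>s::real. q + s *\<^sub>R v) has_derivative (\<lambda>s. s *\<^sub>R v)) (at 0)"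
      by (auto intro!: derivative_eq_intros)
    from has_derivative_compose[OF this, of g A] A(1)
    have "((\<lambda>s::real. g (q + s *\<^sub>R v)) has_derivative (\<lambda>s. A (s *\<^sub>R v))) (at 0)" by simp
    from bounded_linear.has_derivative[OF bounded_linear_inner_left this, of q]
    have d_g: "((\<lambda>s::real. g (q + s *\<^sub>R v) \<bullet> q) has_real_derivative (A v \<bullet> q)) (at 0)"
      by (simp add: has_field_derivative_def linear_cmul[OF lin] mult.commute[of _ "A v \<bullet> q"])
    have d_\<phi>: "((\<lambda>s. \<phi> s powr (m / 2)) has_real_derivative (m / 2 * (2 * (v \<bullet> q) / (q \<bullet> q)))) (at 0)"
      using DERIV_fun_powr[OF \<phi>', of "m / 2"] by (simp add: \<phi>_def)
    have "(\<rho> has_real_derivative (q \<bullet> q) * (m / 2 * (2 * (v \<bullet> q) / (q \<bullet> q))) - A v \<bullet> q) (at 0)"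
      unfolding \<rho>_def by (rule DERIV_diff[OF DERIV_cmult[OF d_\<phi>] d_g])
    moreover have "(q \<bullet> q) * (m / 2 * (2 * (v \<bullet> q) / (q \<bullet> q))) - A v \<bullet> q < 0"
      using contra q0 by simp
    ultimately obtain d1 where d1: "d1 > 0" "\<And>s. 0 < s \<Longrightarrow> s < d1 \<Longrightarrow> \<rho> s < \<rho> 0"
      using DERIV_neg_dec_right by (metis add.left_neutral)
    have "\<phi> 0 = 1" by (simp add: \<phi>_def)
    hence \<rho>0: "\<rho> 0 = 0" by (simp add: \<rho>_def fix_q)
    obtain d2 where d2: "d2 > 0" "\<And>s. 0 < s \<Longrightarrow> s < d2 \<Longrightarrow> \<phi> s < \<phi> 0"
      using DERIV_neg_dec_right[OF \<phi>'] v q0 by (auto simp: divide_neg_pos)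
    have "continuous (at 0) (\<lambda>s::real. norm (q + s *\<^sub>R v))" by (intro continuous_intros)
    hence "((\<lambda>s::real. norm (q + s *\<^sub>R v)) \<longlongrightarrow> norm q) (at 0)" by (simp add: continuous_within)
    hence "\<forall>\<^sub>F s::real in at 0. norm (q + s *\<^sub>R v) > 1" using q by (rule order_tendstoD)
    then obtain d3 where d3: "d3 > 0" "\<And>s::real. \<lbrakk>s \<noteq> 0; \<bar>s\<bar> < d3\<rbrakk> \<Longrightarrow> norm (q + s *\<^sub>R v) > 1"
      by (auto simp: eventually_at dist_real_def)
    define s where "s = min d1 (min d2 d3) / 2"
    have s: "0 < s" "s < d1" "s < d2" "s < d3" using d1(1) d2(1) d3(1) by (auto simp: s_def)
    define z where "z = q + s *\<^sub>R v"
    have z1: "norm z \<ge> 1" using d3(2)[of s] s by (simp add: z_def)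
    have "(norm z / norm q)\<^sup>2 < 1\<^sup>2" using d2(2)[of s] s \<phi>[of s] \<open>\<phi> 0 = 1\<close> by (simp add: z_def)
    hence "norm z / norm q < 1" using power2_less_imp_less by fastforce
    moreover have "norm q > 0" using q by linarith
    ultimately have z2: "norm z \<le> norm q" by (simp add: pos_divide_less_eq)
    have "\<phi> s powr (m / 2) = (norm z / norm q) powr m"
    proof -
      have "norm z / norm q > 0" using z1 q by (intro divide_pos_pos) linarith+
      thus ?thesis using powr_powr[of "norm z / norm q" 2 "m / 2"] by (simp add: \<phi>[symmetric] z_def)
    qed
    moreover have "g z \<bullet> q \<le> norm (g z) * norm q" using norm_cauchy_schwarz by blast
    moreover have "norm (g z) * norm q \<le> norm q * (norm z / norm q) powr m * norm q"
      using bd[OF z1 z2] by (intro mult_right_mono) auto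
    ultimately have "\<rho> s \<ge> 0" by (simp add: \<rho>_def z_def[symmetric] power2_norm_eq_inner[symmetric] power2_eq_square mult_ac)
    thus False using d1(2)[of s] s \<rho>0 by simp
  qed
  from real_left_eigenvector_of_inward_inequality[OF lin q0(1) this]
  obtain k where k: "k \<ge> m" "\<And>v. A v \<bullet> q = k * (v \<bullet> q)" by blast
  have "hermitian_form (A v) q = of_real k * hermitian_form v q" for v
  proof (rule complex_eqI)
    show "Re (hermitian_form (A v) q) = Re (of_real k * hermitian_form v q)"
      by (simp add: Re_hermitian_form k(2))
    have Im: "Im (hermitian_form x q) = - ((\<i> *s x) \<bullet> q)" for x
      by (simp add: Re_hermitian_form[symmetric] hermitian_form_linear)
    show "Im (hermitian_form (A v) q) = Im (of_real k * hermitian_form v q)"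
      using k(2)[of "\<i> *s v"] by (simp add: Im A(2))
  qed
  with k(1) show ?thesis by (rule that)
qed

lemma has_derivative_scaled_matrix:
  fixes f :: "complex ^ 'n \<Rightarrow> complex ^ 'n" and M :: "complex ^ 'n ^ 'n"
  assumes "(f has_derivative D) (at p)"
  shows "((\<lambda>z. a *s (M *v f z)) has_derivative (\<lambda>v. a *s (M *v D v))) (at p)"
proof -
  have "linear (\<lambda>x. a *s (M *v x))"
    by (rule linearI)
       (simp_all add: vec_eq_iff matrix_vector_mult_def algebra_simps sum.distrib sum_distrib_left scaleR_sum_right)
  hence "bounded_linear (\<lambda>x. a *s (M *v x))" by (simp add: linear_conv_bounded_linear)
  from bounded_linear.has_derivative[OF this assms] show ?thesis .
qed

text \<open>All eigenvalues of the derivative at a fixed point have modulus at most \<open>1\<close>. They are expressed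
through eigenvectors \<open>l\<close> of the transposed derivative, because powers of linear forms serve as leading
terms of functions, and because the form found at a maximum point \<open>q\<close> is the hermitian product with \<open>q\<close>.\<close>

definition no_expanding_fixed_points :: "(complex ^ 'n \<Rightarrow> complex ^ 'n) \<Rightarrow> bool" where
  "no_expanding_fixed_points g \<longleftrightarrow> (\<forall>p A l e \<mu>. g p = p \<longrightarrow> (g has_derivative A) (at p) \<longrightarrow>
     (\<forall>c v. A (c *s v) = c *s A v) \<longrightarrow> bounded_linear l \<longrightarrow> (\<forall>c v. l (c *s v) = c * l v) \<longrightarrow>
     l e \<noteq> 0 \<longrightarrow> (\<forall>v. l (A v) = \<mu> * l v) \<longrightarrow> cmod \<mu> \<le> 1)"

lemma no_expanding_fixed_pointsD:
  assumes "no_expanding_fixed_points g" "g p = p" "(g has_derivative A) (at p)"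
    and "\<And>c v. A (c *s v) = c *s A v" "bounded_linear l" "\<And>c v. l (c *s v) = c * l v"
    and "l e \<noteq> 0" "\<And>v. l (A v) = \<mu> * l v"
  shows "cmod \<mu> \<le> 1"
  using assms unfolding no_expanding_fixed_points_def by blast

text \<open>If \<open>\<bar>f z1\<bar> > C \<bar>z1\<bar>\<close>, then also \<open>\<bar>f z1\<bar> > C \<bar>z1\<bar> powr m\<close> for some exponent \<open>m > 1\<close>. At a point \<open>q\<close> that maximises
\<open>\<bar>f z\<bar> / \<bar>z\<bar> powr m\<close> on the shell \<open>1 \<le> \<bar>z\<bar> \<le> \<bar>z1\<bar>\<close> one has \<open>\<bar>q\<bar> > 1\<close>, by the choice of \<open>C\<close>, and
\<open>\<bar>f q\<bar> > \<bar>q\<bar>\<close>. So a rotation and a contraction bring \<open>f q\<close> back to \<open>q\<close>. For the resulting map the boundary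
lemma applies, and it has an eigenvalue \<open>k \<ge> m > 1\<close> at the fixed point \<open>q\<close>.\<close>

lemma linear_growth_of_no_expanding_fixed_points:
  fixes f :: "complex ^ 'n \<Rightarrow> complex ^ 'n"
  assumes card: "CARD('n) \<ge> 2" and f: "holo_map f"
    and nofix: "\<And>a U. \<lbrakk>0 < a; a < 1; U \<in> SU\<rbrakk> \<Longrightarrow>
                  no_expanding_fixed_points (\<lambda>z. complex_of_real a *s (U *v f z))"
  obtains C where "\<And>z. norm z \<ge> 1 \<Longrightarrow> norm (f z) \<le> C * norm z"
proof -
  have cont: "continuous_on S f" for S
    by (intro continuous_at_imp_continuous_on ballI) (metis holo_map_has_derivative[OF f] has_derivative_continuous)
  have "bounded (f ` sphere 0 1)" by (intro compact_imp_bounded compact_continuous_image cont) auto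
  then obtain M where "\<forall>y\<in>f ` sphere 0 1. norm y \<le> M" unfolding bounded_iff by blast
  hence M: "norm (f z) \<le> M" if "norm z = 1" for z using that by simp
  define C where "C = max 1 M"
  have "norm (f z1) \<le> C * norm z1" if z1: "norm z1 \<ge> 1" for z1
  proof (rule ccontr)
    assume "\<not> norm (f z1) \<le> C * norm z1"
    hence big: "norm (f z1) / C > norm z1" by (simp add: C_def field_simps)
    define r where "r = norm z1"
    have r1: "r > 1"
    proof (rule ccontr)
      assume "\<not> r > 1"
      hence n1: "norm z1 = 1" using z1 by (simp add: r_def)
      have "norm (f z1) \<le> C" "C > 0" using M[OF n1] by (simp_all add: C_def)
      thus False using big n1 by (simp add: field_simps)
    qed
    define L where "L = log r (norm (f z1) / C)"
    have X0: "norm (f z1) / C > 0" using big z1 by linarith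
    have rL: "r powr L = norm (f z1) / C" using r1 X0 by (simp add: L_def)
    have L1: "L > 1" using big r1 X0 by (simp add: L_def less_log_iff r_def[symmetric])
    \<comment> \<open>\<open>L\<close> is the exponent with \<open>C \<bar>z1\<bar> powr L = \<bar>f z1\<bar>\<close>; any \<open>m\<close> strictly between \<open>1\<close> and \<open>L\<close> does.\<close>
    define m where "m = (1 + L) / 2"
    have m: "m > 1" "m < L" using L1 by (auto simp: m_def)
    have "r powr m < norm (f z1) / C" using powr_less_mono[OF m(2) r1] rL by simp
    hence z1m: "C * r powr m < norm (f z1)" by (simp add: C_def field_simps)
    define \<Phi> where "\<Phi> = (\<lambda>z. norm (f z) / norm z powr m)"
    define S :: "(complex ^ 'n) set" where "S = cball 0 r - ball 0 1"
    have S: "z \<in> S \<longleftrightarrow> 1 \<le> norm z \<and> norm z \<le> r" for z by (auto simp: S_def)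
    have "compact S" unfolding S_def by (intro compact_diff) auto
    moreover have "continuous_on S \<Phi>" unfolding \<Phi>_def
      by (intro continuous_intros cont) (auto simp: S)
    moreover have "z1 \<in> S" using z1 by (simp add: S r_def)
    ultimately obtain q where q: "q \<in> S" "\<And>z. z \<in> S \<Longrightarrow> \<Phi> z \<le> \<Phi> q"
      using continuous_attains_sup[of S \<Phi>] by blast
    have "C < \<Phi> z1" using z1m r1 by (simp add: \<Phi>_def r_def[symmetric] field_simps)
    also have "\<Phi> z1 \<le> \<Phi> q" using q(2) \<open>z1 \<in> S\<close> by blast
    finally have \<Phi>q: "\<Phi> q > C" .
    have "norm q \<noteq> 1"
    proof
      assume "norm q = 1"
      hence "\<Phi> q \<le> C" using M[of q] by (simp add: \<Phi>_def C_def)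
      thus False using \<Phi>q by simp
    qed
    hence q1: "norm q > 1" using q(1) by (simp add: S)
    have qm: "norm q < norm q powr m" using powr_less_mono[OF m(1) q1] q1 by simp
    have P: "norm q powr m > 0" using q1 by auto
    have "norm q powr m \<le> C * norm q powr m" by (simp add: C_def mult_le_cancel_right1)
    also have "\<dots> < norm (f q)" using \<Phi>q P by (simp add: \<Phi>_def pos_less_divide_eq)
    finally have fq: "norm (f q) > norm q" using qm by simp
    define a where "a = norm q / norm (f q)"
    have fq0: "norm (f q) > 0" using fq q1 by linarith
    have a: "0 < a" unfolding a_def using q1 fq0 by (intro divide_pos_pos) linarith+
    have a1: "a < 1" unfolding a_def using fq fq0 by (simp add: pos_divide_less_eq)
    have "norm (f q) = norm (complex_of_real (1 / a) *s q)"
      using q1 by (auto simp: norm_vector_scalar_mult norm_divide a_def)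
    moreover have "f q \<noteq> 0" using fq0 by auto
    ultimately obtain U where U: "U \<in> SU" "U *v f q = complex_of_real (1 / a) *s q"
      using SU_transitive_on_spheres[OF card] by metis
    define g where "g = (\<lambda>z. complex_of_real a *s (U *v f z))"
    have gq: "g q = q" using a by (simp add: g_def U(2))
    obtain D where D: "(f has_derivative D) (at q)" "\<And>c v. D (c *s v) = c *s D v"
      using holo_map_has_derivative[OF f] by blast
    define A where "A = (\<lambda>v. complex_of_real a *s (U *v D v))"
    have A: "(g has_derivative A) (at q)" "\<And>c v. A (c *s v) = c *s A v"
      unfolding g_def A_def
      by (rule has_derivative_scaled_matrix[OF D(1)]) (simp add: D(2) vector_scalar_commute mult.commute)
    have gn: "norm (g z) = a * norm (f z)" for z
      using norm_unitary_matrix[of U "f z"] U(1) a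
      by (simp add: g_def SU_iff norm_vector_scalar_mult)
    have "norm (g z) \<le> norm q * (norm z / norm q) powr m" if z: "1 \<le> norm z" "norm z \<le> norm q" for z
    proof -
      have "\<Phi> z \<le> \<Phi> q" using q z by (auto simp: S)
      moreover have "norm z powr m > 0" using z(1) by auto
      ultimately have "norm (f z) \<le> norm (f q) / norm q powr m * norm z powr m"
        by (simp add: \<Phi>_def pos_divide_le_eq)
      hence "a * norm (f z) \<le> a * (norm (f q) / norm q powr m * norm z powr m)"
        using a by (intro mult_left_mono) auto
      also have "\<dots> = norm q * (norm z / norm q) powr m"
        using fq0 z q1 by (simp add: a_def powr_divide)
      finally show ?thesis by (simp add: gn)
    qed
    from left_eigenvector_at_boundary_fixed_point[OF gq q1 A this] obtain k
      where k: "k \<ge> m" "\<And>v. hermitian_form (A v) q = of_real k * hermitian_form v q" by blast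
    have "hermitian_form q q \<noteq> 0" using q1 by (auto simp: hermitian_form_self)
    from no_expanding_fixed_pointsD[OF nofix[OF a a1 U(1), folded g_def] gq A
        bounded_linear_hermitian_form hermitian_form_linear(4) this k(2)]
    have "cmod (of_real k) \<le> 1" .
    thus False using k(1) m(1) by simp
  qed
  thus ?thesis by (rule that)
qed

lemma affine_of_linear_growth:
  fixes f :: "complex ^ 'n \<Rightarrow> complex ^ 'n"
  assumes f: "holo_map f" and C: "\<And>z. norm z \<ge> 1 \<Longrightarrow> norm (f z) \<le> C * norm z"
  shows "affine_map f"
proof -
  obtain D where D: "(f has_derivative D) (at 0)" "\<And>c v. D (c *s v) = c *s D v"
    using holo_map_has_derivative[OF f] by blast
  have comp: "f z $ i = f 0 $ i + D z $ i" for z i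
  proof (cases "z = 0")
    case True
    thus ?thesis using linear_0[OF has_derivative_linear[OF D(1)]] by simp
  next
    case False
    define \<phi> where "\<phi> = (\<lambda>\<zeta>. f (\<zeta> *s z) $ i)"
    have hol: "\<phi> holomorphic_on UNIV"
      using holomorphic_on_entire_along_line[of "\<lambda>z. f z $ i" 0 z] f by (simp add: \<phi>_def holo_map_def)
    note nz = norm_vector_scalar_mult
    have "\<phi> 1 = (\<Sum>k\<le>1. (deriv ^^ k) \<phi> 0 / fact k * 1 ^ k)"
    proof (rule Liouville_polynomial[OF hol])
      fix \<zeta> :: complex assume "1 / norm z \<le> cmod \<zeta>"
      hence "norm (\<zeta> *s z) \<ge> 1" using False by (simp add: nz field_simps)
      from C[OF this] show "cmod (\<phi> \<zeta>) \<le> (C * norm z) * cmod \<zeta> ^ 1"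
        using order_trans[OF Finite_Cartesian_Product.norm_nth_le[of "f (\<zeta> *s z)" i]]
        by (simp add: \<phi>_def nz mult_ac)
    qed
    moreover have "deriv \<phi> 0 = D z $ i"
    proof (rule DERIV_imp_deriv)
      have "((\<lambda>\<zeta>. f (0 + \<zeta> *s z)) has_derivative (\<lambda>\<zeta>. D (\<zeta> *s z))) (at 0)"
        using has_derivative_compose[OF has_derivative_vector_scalar_line[of 0 z 0], of f D] D(1) by simp
      from bounded_linear.has_derivative[OF bounded_linear_vec_nth[of i] this]
      show "(\<phi> has_field_derivative D z $ i) (at 0)"
        by (simp add: \<phi>_def has_field_derivative_def D(2) mult.commute[of _ "D z $ i"])
    qed
    ultimately show ?thesis by (simp add: \<phi>_def)
  qed
  have "f z = D z + f 0" for z by (simp add: vec_eq_iff comp[of z])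
  moreover have "Vector_Spaces.linear (*s) (*s) D"
    using linear_add[OF has_derivative_linear[OF D(1)]] D(2)
    by (simp add: Vector_Spaces.linear_iff vec.vector_space_axioms)
  hence "matrix D *v z = D z" for z by (rule matrix_works)
  ultimately show ?thesis unfolding affine_map_def by metis
qed

section \<open>Dimension one\<close>

text \<open>In dimension one only the trivial rotation has determinant \<open>1\<close>. For \<open>t > 1\<close> a solution of \<open>f z = t z\<close> is a
fixed point of \<open>f / t\<close>, so that the derivative of \<open>f\<close> there is at most \<open>t\<close> in modulus.\<close>

lemma affine_of_no_expanding_fixed_points_dim_1:
  fixes f :: "complex ^ 'n \<Rightarrow> complex ^ 'n"
  assumes card: "CARD('n) = 1" and f: "holo_map f"
    and nofix: "\<And>a U. \<lbrakk>0 < a; a < 1; U \<in> SU\<rbrakk> \<Longrightarrow>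
                  no_expanding_fixed_points (\<lambda>z. complex_of_real a *s (U *v f z))"
  shows "affine_map f"
proof -
  obtain i :: 'n where i: "UNIV = {i}" using card by (metis card_1_singletonE)
  have eq_i: "k = i" for k using i by blast
  have vec_i: "x = (x $ i) *s 1" for x :: "complex ^ 'n" by (simp add: vec_eq_iff) (metis eq_i)
  define \<phi> where "\<phi> = (\<lambda>\<zeta>. f (\<zeta> *s 1) $ i)"
  have hol: "\<phi> holomorphic_on UNIV"
    using holomorphic_on_entire_along_line[of "\<lambda>z. f z $ i" 0 1] f by (simp add: \<phi>_def holo_map_def)
  have one_SU: "mat 1 \<in> (SU :: (complex ^ 'n ^ 'n) set)"
    by (simp add: SU_iff unitary_matrix_one)
  have "cmod (deriv \<phi> \<zeta>) \<le> t" if t: "t > 1" "\<phi> \<zeta> = of_real t * \<zeta>" for t \<zeta>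
  proof -
    define p :: "complex ^ 'n" where "p = \<zeta> *s 1"
    define g where "g = (\<lambda>z. complex_of_real (1 / t) *s (mat 1 *v f z))"
    obtain D where D: "(f has_derivative D) (at p)" "\<And>c v. D (c *s v) = c *s D v"
      using holo_map_has_derivative[OF f] by blast
    define A where "A = (\<lambda>v. complex_of_real (1 / t) *s (mat 1 *v D v))"
    have A: "(g has_derivative A) (at p)" unfolding g_def A_def
      by (rule has_derivative_scaled_matrix[OF D(1)])
    have A_scale: "A (c *s v) = c *s A v" for c v by (simp add: A_def D(2) mult.commute)
    have "f p = (of_real t * \<zeta>) *s 1" using t(2) vec_i[of "f p"] by (simp add: \<phi>_def p_def)
    hence gp: "g p = p" using t(1) by (simp add: g_def p_def)
    have D_i: "D v $ i = v $ i * D 1 $ i" for v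
      using D(2)[of "v $ i" 1] vec_i[of v] by (metis vector_smult_component)
    have eig: "A v $ i = (D 1 $ i / of_real t) * v $ i" for v by (simp add: A_def D_i[of v])
    have "0 < 1 / t" "1 / t < 1" using t(1) by simp_all
    from nofix[OF this one_SU] have "no_expanding_fixed_points g" by (simp only: g_def)
    from no_expanding_fixed_pointsD[OF this gp A A_scale bounded_linear_vec_nth _ _ eig, of 1]
    have "cmod (D 1 $ i / of_real t) \<le> 1" by simp
    moreover have "deriv \<phi> \<zeta> = D 1 $ i"
    proof (rule DERIV_imp_deriv)
      have "(f has_derivative D) (at (0 + \<zeta> *s 1))" using D(1) by (simp add: p_def)
      from has_derivative_compose[OF has_derivative_vector_scalar_line this]
      have "((\<lambda>\<zeta>. f (0 + \<zeta> *s 1)) has_derivative (\<lambda>\<zeta>. D (\<zeta> *s 1))) (at \<zeta>)" .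
      from bounded_linear.has_derivative[OF bounded_linear_vec_nth[of i] this]
      have "(\<phi> has_derivative (\<lambda>\<zeta>. D (\<zeta> *s 1) $ i)) (at \<zeta>)" by (simp only: \<phi>_def add_0)
      moreover have "(\<lambda>\<zeta>. D (\<zeta> *s 1) $ i) = (*) (D 1 $ i)"
        by (rule ext) (simp only: D(2) vector_smult_component mult.commute)
      ultimately show "(\<phi> has_field_derivative D 1 $ i) (at \<zeta>)"
        by (simp only: has_field_derivative_def)
    qed
    ultimately show ?thesis using t(1) by (simp add: norm_divide field_simps)
  qed
  from affine_of_contracting_ray_solutions[OF hol this] obtain a b
    where ab: "\<And>\<zeta>. \<phi> \<zeta> = a * \<zeta> + b" by blast
  have "f z = mat a *v z + b *s 1" for z
  proof -
    have "f z $ i = a * z $ i + b" using ab[of "z $ i"] vec_i[of z] by (simp add: \<phi>_def)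
    hence "f z $ k = (mat a *v z + b *s 1) $ k" for k
      using eq_i[of k] by (simp add: matrix_vector_mult_def mat_def i)
    thus ?thesis by (simp add: vec_eq_iff)
  qed
  thus ?thesis unfolding affine_map_def by blast
qed

section \<open>Affine symbols\<close>

lemma entire_isCont:
  assumes "h \<in> entire"
  shows "isCont h p"
proof -
  obtain D where "(h has_derivative D) (at p)" using assms unfolding entire_def holo_on_def by blast
  thus ?thesis by (rule has_derivative_continuous)
qed

lemma wcomp_bounded_compose:
  assumes qn: "quasi_norm V N" and u: "wcomp_bounded V N u f" and v: "wcomp_bounded V N v g"
  shows "wcomp_bounded V N (\<lambda>z. u z * v (f z)) (g \<circ> f)"
proof -
  have eq: "wcomp (\<lambda>z. u z * v (f z)) (g \<circ> f) h = wcomp u f (wcomp v g h)" for h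
    by (simp add: wcomp_def mult.assoc)
  have V: "wcomp u f h \<in> V" "wcomp v g h \<in> V" if "h \<in> V" for h
    using u v that by (auto simp: wcomp_bounded_def wcomp_dom_def)
  obtain C D where C: "\<And>h. h \<in> V \<Longrightarrow> N (wcomp u f h) \<le> C * N h"
    and D: "\<And>h. h \<in> V \<Longrightarrow> N (wcomp v g h) \<le> D * N h"
    using u v unfolding wcomp_bounded_def by blast
  have "N (wcomp u f (wcomp v g h)) \<le> (max C 0 * D) * N h" if "h \<in> V" for h
  proof -
    have N0: "N (wcomp v g h) \<ge> 0" using qn V(2)[OF that] by (auto simp: quasi_norm_def)
    have "N (wcomp u f (wcomp v g h)) \<le> C * N (wcomp v g h)" using C V(2)[OF that] by blast
    also have "\<dots> \<le> max C 0 * N (wcomp v g h)" using N0 by (intro mult_right_mono) auto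
    also have "\<dots> \<le> max C 0 * (D * N h)" using D[OF that] by (intro mult_left_mono) auto
    finally show ?thesis by (simp add: mult.assoc)
  qed
  thus ?thesis unfolding wcomp_bounded_def wcomp_dom_def eq using V by blast
qed

theorem theorem1p4:
  fixes V :: "(complex ^ 'n \<Rightarrow> complex) set"
    and N :: "(complex ^ 'n \<Rightarrow> complex) \<Rightarrow> real"
    and f :: "complex ^ 'n \<Rightarrow> complex ^ 'n"
    and u :: "complex ^ 'n \<Rightarrow> complex"
  assumes "quasi_Banach V N"
    and "continuously_included V N"
    and "\<And>p. infinite {n. graded_piece p n = graded_piece_of V p n}"
    and "\<And>a U. 0 < a \<Longrightarrow> a < 1 \<Longrightarrow> U \<in> SU \<Longrightarrow>
           \<exists>v\<in>entire. nonvanishing v \<and> wcomp_bounded V N v (\<lambda>z. complex_of_real a *s (U *v z))"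
    and "holo_map f"
    and "u \<in> entire" and "nonvanishing u"
    and "wcomp_bounded V N u f"
  shows "affine_map f"
proof -
  have V: "function_subspace V" "quasi_norm V N" using assms(1) by (auto simp: quasi_Banach_def)
  have nofix: "no_expanding_fixed_points (\<lambda>z. complex_of_real a *s (U *v f z))"
    if aU: "0 < a" "a < 1" "U \<in> SU" for a U
  proof -
    obtain v where v: "v \<in> entire" "nonvanishing v"
      "wcomp_bounded V N v (\<lambda>z. complex_of_real a *s (U *v z))"
      using assms(4)[OF aU] by blast
    have bdd: "wcomp_bounded V N (\<lambda>z. u z * v (f z)) (\<lambda>z. complex_of_real a *s (U *v f z))"
      using wcomp_bounded_compose[OF V(2) assms(8) v(3)] by (simp add: o_def)
    have nz: "u z * v (f z) \<noteq> 0" for z using assms(7) v(2) by (simp add: nonvanishing_def)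
    have "isCont f p" for p
      using holo_map_has_derivative[OF assms(5)] has_derivative_continuous by metis
    hence cont: "isCont (\<lambda>z. u z * v (f z)) p" for p
      by (intro continuous_mult entire_isCont assms(6) isCont_o2[where g = v] v(1))
    show ?thesis
      unfolding no_expanding_fixed_points_def
    proof (intro allI impI)
      fix p A l e \<mu>
      assume "complex_of_real a *s (U *v f p) = p"
        "((\<lambda>z. complex_of_real a *s (U *v f z)) has_derivative A) (at p)"
        "\<forall>c v. A (c *s v) = c *s A v" "bounded_linear l" "\<forall>c v. l (c *s v) = c * l v"
        "l e \<noteq> 0" "\<forall>v. l (A v) = \<mu> * l v"
      thus "cmod \<mu> \<le> 1"
        using cotangent_eigenvalue_le_1[OF V assms(2) assms(3) bdd cont nz, of p A l e \<mu>] by blast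
    qed
  qed
  show ?thesis
  proof (cases "CARD('n) \<ge> 2")
    case True
    obtain C where "\<And>z. norm z \<ge> 1 \<Longrightarrow> norm (f z) \<le> C * norm z"
      using linear_growth_of_no_expanding_fixed_points[OF True assms(5) nofix] by blast
    thus ?thesis by (rule affine_of_linear_growth[OF assms(5)])
  next
    case False
    moreover have "CARD('n) > 0" by simp
    ultimately have "CARD('n) = 1" by linarith
    thus ?thesis using affine_of_no_expanding_fixed_points_dim_1[OF _ assms(5) nofix] by blast
  qed
qed

end
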